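(* Let $d\ge 1$, let $\Gamma$ be a finite alphabet and let $x:\mathbb{N}^d\to\Gamma$ be a $d$-dimensional infinite word over $\Gamma$. Then the following are equivalent: (1) $x$ is $S$-automatic for some abstract numeration system $S=(L,\Sigma,<)$ with $\varepsilon\in L$; (2) $x$ is the image by a coding of a shape-symmetric $d$-dimensional infinite word, i.e., there exist a finite alphabet $\Xi$, a $d$-dimensional morphism $\mu:\Xi\to B_d(\Xi)$ prolongable on a letter $a\in\Xi$ such that $\mu^\omega(a)$ is a $d$-dimensional infinite word that is shape-symmetric with respect to $\mu$, and a coding $\nu:\Xi\to\Gamma$, such that $x=\nu(\mu^\omega(a))$.
   Context: $\mathbb{N}=\{0,1,2,\ldots\}$; $\varepsilon$ is the empty word; all words and pictures are indexed starting from $0$. Abstract numeration systems. For a totally ordered finite alphabet $(\Sigma,<)$, the genealogical order on $\Sigma^*$ is: $u\prec v$ if $|u|<|v|$, or $|u|=|v|$ and $u$ is lexicographically less than $v$. An abstract numeration system is a triple $S=(L,\Sigma,<)$ where $L$ is an infinite regular language over a totally ordered finite alphabet $(\Sigma,<)$. The map $\mathrm{rep}_S:\mathbb{N}\to L$ sends $n$ to the $(n+1)$st word of $L$ in genealogical order. $S$-automatic words. Let $\#\notin\Sigma$ and $\Sigma_\#=\Sigma\cup\{\#\}$. For $w_1,\ldots,w_d\in\Sigma^*$ and $m=\max_i|w_i|$, put $(w_1,\ldots,w_d)^\#=(\#^{m-|w_1|}w_1,\ldots,\#^{m-|w_d|}w_d)$, viewed as a word of length $m$ over the alphabet $(\Sigma_\#)^d$.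 A deterministic finite automaton with output (DFAO) is $(Q,q_0,A,\delta,\Gamma,\tau)$ with finite state set $Q$, initial state $q_0$, input alphabet $A$, transition function $\delta:Q\times A\to Q$ (extended to $Q\times A^*$ as usual, reading words from left to right) and output function $\tau:Q\to\Gamma$. A $d$-dimensional infinite word over $\Gamma$ is a map $x:\mathbb{N}^d\to\Gamma$. It is $S$-automatic if there is a DFAO $(Q,q_0,(\Sigma_\#)^d,\delta,\Gamma,\tau)$ such that $\tau(\delta(q_0,(\mathrm{rep}_S(n_1),\ldots,\mathrm{rep}_S(n_d))^\#))=x(n_1,\ldots,n_d)$ for all $n_1,\ldots,n_d\ge0$. Pictures. A $d$-dimensional picture over $\Xi$ of shape $|x|=(s_1,\ldots,s_d)$, where each $s_i$ is a positive integer or $\infty$, is a map $x$ from $\{(n_1,\ldots,n_d)\in\mathbb{N}^d: n_i<s_i \text{ for all } i\}$ to $\Xi$; there is also the empty picture $\varepsilon_d$ of shape $(0,\ldots,0)$. We write $|x|_i=s_i$. A picture is bounded if all $s_i$ are finite; $B_d(\Xi)$ is the set of bounded $d$-dimensional pictures over $\Xi$. Two pictures whose shapes agree in every coordinate except possibly the $i$th can be concatenated in direction $i$ by juxtaposing them along the $i$th coordinate. Multidimensional morphisms. Let $\mu:\Xi\to B_d(\Xi)$ be a map and let $x$ be a $d$-dimensional picture over $\Xi$. The picture $\mu(x)$ is well defined if, for every $i\in\{1,\ldots,d\}$ and every $k<|x|_i$, any two letters $b,c$ occurring in $x$ at positions whose $i$th coordinate is $k$ satisfy $|\mu(b)|_i=|\mu(c)|_i$.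 In that case $\mu(x)$ is obtained from $x$ by replacing each letter $x(\mathbf{n})$ by the block $\mu(x(\mathbf{n}))$ and concatenating all these blocks in the directions $1,\ldots,d$, respecting their positions. The map $\mu$ is a $d$-dimensional morphism if for all $b\in\Xi$ and all $n\ge1$, $\mu^n(b)=\mu(\mu^{n-1}(b))$ is well defined (with $\mu^0(b)=b$). It is prolongable on $a\in\Xi$ if the letter of $\mu(a)$ at position $(0,\ldots,0)$ is $a$; then $\mu^\omega(a)=\lim_{n\to\infty}\mu^n(a)$ exists and is a fixed point of $\mu$. A coding is a letter-to-letter map $\nu:\Xi\to\Gamma$, applied to words letter by letter. Shape-symmetry. Let $\mu:\Xi\to B_d(\Xi)$ be a $d$-dimensional morphism prolongable on $a$ such that $y=\mu^\omega(a)$ is a $d$-dimensional infinite word (that is, of shape $(\infty,\ldots,\infty)$). Then $y$ is shape-symmetric with respect to $\mu$ if for every permutation $f$ of $\{1,\ldots,d\}$ and all $n_1,\ldots,n_d\ge 0$: whenever $|\mu(y(n_1,\ldots,n_d))|=(s_1,\ldots,s_d)$, then $|\mu(y(n_{f(1)},\ldots,n_{f(d)}))|=(s_{f(1)},\ldots,s_{f(d)})$. *)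

theory Defs
  imports Complex_Main "HOL-Library.Extended_Nat" "HOL-Library.FuncSet"
begin

section \<open>Abstract numeration systems\<close>

text \<open>
  Existentially quantified finite sets (states of automata, alphabets) are taken inside
  \<^typ>\<open>nat\<close>, which contains a copy of every finite set. The order of an alphabet is an
  arbitrary strict linear order \<open>r\<close>, unrelated to the usual order of \<^typ>\<open>nat\<close>.
\<close>

definition regular :: "'a set \<Rightarrow> 'a list set \<Rightarrow> bool" where
  "regular \<Sigma> L \<longleftrightarrow>
    (\<exists>(Q :: nat set) q0 \<delta> F. finite Q \<and> q0 \<in> Q \<and> (\<forall>q\<in>Q. \<forall>c\<in>\<Sigma>. \<delta> q c \<in> Q) \<and> F \<subseteq> Q \<and>
       L = {w \<in> lists \<Sigma>. foldl \<delta> q0 w \<in> F})"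

definition abstract_numeration_system :: "'a list set \<Rightarrow> 'a set \<Rightarrow> 'a rel \<Rightarrow> bool" where
  "abstract_numeration_system L \<Sigma> r \<longleftrightarrow>
    finite \<Sigma> \<and> r \<subseteq> \<Sigma> \<times> \<Sigma> \<and> strict_linear_order_on \<Sigma> r \<and>
    L \<subseteq> lists \<Sigma> \<and> regular \<Sigma> L \<and> infinite L"

text \<open>\<^term>\<open>lenlex r\<close> is the genealogical order: first by length, then lexicographically.\<close>

definition rep :: "'a list set \<Rightarrow> 'a rel \<Rightarrow> nat \<Rightarrow> 'a list" where
  "rep L r n = (THE w. w \<in> L \<and> card {v \<in> L. (v, w) \<in> lenlex r} = n)"


section \<open>Automatic words\<close>

text \<open>
  Dimension \<open>d\<close> is the cardinality of the finite (hence nonempty) index type \<^typ>\<open>'d\<close>; a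
  \<open>d\<close>-tuple is a function on \<^typ>\<open>'d\<close>. The padding symbol is \<^term>\<open>None\<close>, and a letter
  \<open>c\<close> of the alphabet becomes \<^term>\<open>Some c\<close>.
\<close>

definition padded_alphabet :: "'a set \<Rightarrow> ('d \<Rightarrow> 'a option) set" where
  "padded_alphabet \<Sigma> = {c. \<forall>i. c i \<in> insert None (Some ` \<Sigma>)}"

definition pad :: "('d::finite \<Rightarrow> 'a list) \<Rightarrow> ('d \<Rightarrow> 'a option) list" where
  "pad w = (let m = Max (range (\<lambda>i. length (w i))) in
     map (\<lambda>k i. (replicate (m - length (w i)) None @ map Some (w i)) ! k) [0..<m])"

record ('q, 'a, 'g) dfao =
  states :: "'q set"
  init :: 'q
  trans :: "'q \<Rightarrow> 'a \<Rightarrow> 'q"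
  out :: "'q \<Rightarrow> 'g"

definition is_dfao :: "'a set \<Rightarrow> 'g set \<Rightarrow> ('q, 'a, 'g) dfao \<Rightarrow> bool" where
  "is_dfao A \<Gamma> M \<longleftrightarrow> finite (states M) \<and> init M \<in> states M \<and>
    (\<forall>q\<in>states M. \<forall>c\<in>A. trans M q c \<in> states M) \<and> (\<forall>q\<in>states M. out M q \<in> \<Gamma>)"

definition dfao_output :: "('q, 'a, 'g) dfao \<Rightarrow> 'a list \<Rightarrow> 'g" where
  "dfao_output M w = out M (foldl (trans M) (init M) w)"

definition automatic ::
  "'a list set \<Rightarrow> 'a set \<Rightarrow> 'a rel \<Rightarrow> 'g set \<Rightarrow> (('d::finite \<Rightarrow> nat) \<Rightarrow> 'g) \<Rightarrow> bool" where
  "automatic L \<Sigma> r \<Gamma> x \<longleftrightarrow>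
    (\<exists>M :: (nat, 'd \<Rightarrow> 'a option, 'g) dfao. is_dfao (padded_alphabet \<Sigma>) \<Gamma> M \<and>
       (\<forall>n. dfao_output M (pad (\<lambda>i. rep L r (n i))) = x n))"


section \<open>Pictures\<close>

definition box :: "('d \<Rightarrow> enat) \<Rightarrow> ('d \<Rightarrow> nat) set" where
  "box s = {n. \<forall>i. enat (n i) < s i}"

datatype ('d, 'a) picture = Picture (shape: "'d \<Rightarrow> enat") (letter: "('d \<Rightarrow> nat) \<Rightarrow> 'a")

text \<open>
  Outside its box the letter function of a picture is \<^term>\<open>undefined\<close>, so that equality of
  pictures is equality of shapes and of letters inside the box.
\<close>

definition pictures :: "'a set \<Rightarrow> ('d, 'a) picture set" where
  "pictures \<Xi> = {x. ((\<forall>i. shape x i > 0) \<or> (\<forall>i. shape x i = 0)) \<and>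
                     letter x \<in> box (shape x) \<rightarrow>\<^sub>E \<Xi>}"

definition bounded_pictures :: "'a set \<Rightarrow> ('d, 'a) picture set" where
  "bounded_pictures \<Xi> = {x \<in> pictures \<Xi>. \<forall>i. shape x i \<noteq> \<infinity>}"

definition infinite_word :: "('d, 'a) picture \<Rightarrow> bool" where
  "infinite_word x \<longleftrightarrow> (\<forall>i. shape x i = \<infinity>)"

definition letter_picture :: "'a \<Rightarrow> ('d, 'a) picture" where
  "letter_picture b = Picture (\<lambda>_. 1) (\<lambda>n\<in>box (\<lambda>_. 1). b)"


section \<open>Multidimensional morphisms\<close>

definition image_well_defined :: "('a \<Rightarrow> ('d, 'b) picture) \<Rightarrow> ('d, 'a) picture \<Rightarrow> bool" where
  "image_well_defined \<mu> x \<longleftrightarrow>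
    (\<forall>i. \<forall>m\<in>box (shape x). \<forall>n\<in>box (shape x). m i = n i \<longrightarrow>
       shape (\<mu> (letter x m)) i = shape (\<mu> (letter x n)) i)"

text \<open>
  In direction \<open>i\<close>, all blocks of \<open>\<mu>(x)\<close> coming from letters with \<open>i\<close>th coordinate \<open>k\<close>
  have the same width if \<open>\<mu>(x)\<close> is well defined; it is read off at the position with \<open>i\<close>th
  coordinate \<open>k\<close> and all other coordinates 0. The block of the letter at position \<open>n\<close> then
  starts at position \<open>\<lambda>i. block_start \<mu> x i (n i)\<close>, and coordinate \<open>p\<close> in direction \<open>i\<close>
  is covered by the blocks of index \<open>block_index \<mu> x i p\<close>.
\<close>

definition block_width :: "('a \<Rightarrow> ('d, 'b) picture) \<Rightarrow> ('d, 'a) picture \<Rightarrow> 'd \<Rightarrow> nat \<Rightarrow> nat" where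
  "block_width \<mu> x i k = the_enat (shape (\<mu> (letter x ((\<lambda>_. 0)(i := k)))) i)"

definition block_start :: "('a \<Rightarrow> ('d, 'b) picture) \<Rightarrow> ('d, 'a) picture \<Rightarrow> 'd \<Rightarrow> nat \<Rightarrow> nat" where
  "block_start \<mu> x i m = (\<Sum>k<m. block_width \<mu> x i k)"

definition block_index :: "('a \<Rightarrow> ('d, 'b) picture) \<Rightarrow> ('d, 'a) picture \<Rightarrow> 'd \<Rightarrow> nat \<Rightarrow> nat" where
  "block_index \<mu> x i p = (LEAST m. p < block_start \<mu> x i (Suc m))"

definition apply_morphism ::
  "('a \<Rightarrow> ('d, 'b) picture) \<Rightarrow> ('d, 'a) picture \<Rightarrow> ('d, 'b) picture" where
  "apply_morphism \<mu> x =
    (let s = (\<lambda>i. SUP m\<in>{m. enat m \<le> shape x i}. enat (block_start \<mu> x i m)) in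
     Picture s
       (\<lambda>p\<in>box s. let n = (\<lambda>i. block_index \<mu> x i (p i)) in
          letter (\<mu> (letter x n)) (\<lambda>i. p i - block_start \<mu> x i (n i))))"

primrec morphism_power ::
  "('a \<Rightarrow> ('d, 'a) picture) \<Rightarrow> nat \<Rightarrow> 'a \<Rightarrow> ('d, 'a) picture" where
  "morphism_power \<mu> 0 b = letter_picture b"
| "morphism_power \<mu> (Suc n) b = apply_morphism \<mu> (morphism_power \<mu> n b)"

definition multidim_morphism :: "'a set \<Rightarrow> ('a \<Rightarrow> ('d, 'a) picture) \<Rightarrow> bool" where
  "multidim_morphism \<Xi> \<mu> \<longleftrightarrow> \<mu> \<in> \<Xi> \<rightarrow> bounded_pictures \<Xi> \<and>
    (\<forall>b\<in>\<Xi>. \<forall>n\<ge>1. image_well_defined \<mu> (morphism_power \<mu> (n - 1) b))"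

definition prolongable :: "('a \<Rightarrow> ('d, 'a) picture) \<Rightarrow> 'a \<Rightarrow> bool" where
  "prolongable \<mu> a \<longleftrightarrow> (\<lambda>_. 0) \<in> box (shape (\<mu> a)) \<and> letter (\<mu> a) (\<lambda>_. 0) = a"

text \<open>
  For a morphism prolongable on \<open>a\<close>, each \<open>\<mu>\<^sup>n(a)\<close> is a prefix of \<open>\<mu>\<^sup>n\<^sup>+\<^sup>1(a)\<close>
  (lemma \<open>morphism_power_prefix\<close> below), and the limit is the union of this chain.
\<close>

definition morphism_limit :: "('a \<Rightarrow> ('d, 'a) picture) \<Rightarrow> 'a \<Rightarrow> ('d, 'a) picture" where
  "morphism_limit \<mu> a =
    (let s = (\<lambda>i. SUP n. shape (morphism_power \<mu> n a) i) in
     Picture s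
       (\<lambda>p\<in>box s. letter
          (morphism_power \<mu> (LEAST n. p \<in> box (shape (morphism_power \<mu> n a))) a) p))"

definition shape_symmetric :: "('a \<Rightarrow> ('d, 'a) picture) \<Rightarrow> ('d, 'a) picture \<Rightarrow> bool" where
  "shape_symmetric \<mu> y \<longleftrightarrow>
    (\<forall>f n. bij f \<longrightarrow>
       shape (\<mu> (letter y (\<lambda>i. n (f i)))) = (\<lambda>i. shape (\<mu> (letter y n)) (f i)))"

section \<open>Adequacy of the definitions\<close>

lemma the_enat_0: "the_enat 0 = 0"
  by (simp add: zero_enat_def)

lemma zero_in_box_iff: "(\<lambda>_. 0) \<in> box s \<longleftrightarrow> (\<forall>i. s i > 0)"
  by (simp add: box_def zero_enat_def[symmetric])

lemma box_one: "p \<in> box (\<lambda>_. 1) \<longleftrightarrow> p = (\<lambda>_. 0)"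
  by (auto simp: box_def one_enat_def)

lemma axis_in_box:
  assumes "n \<in> box s"
  shows "(\<lambda>_. 0)(i := n i) \<in> box s"
proof -
  have "enat (((\<lambda>_. 0)(i := n i)) j) < s j" for j
  proof (rule le_less_trans)
    show "enat (((\<lambda>_. 0)(i := n i)) j) \<le> enat (n j)" by simp
    show "enat (n j) < s j" using assms by (simp add: box_def)
  qed
  then show ?thesis by (simp add: box_def)
qed

lemma shape_apply_morphism_finite:
  assumes "shape x i = enat m"
  shows "shape (apply_morphism \<mu> x) i = enat (block_start \<mu> x i m)"
proof -
  have "(SUP k\<in>{k. enat k \<le> shape x i}. enat (block_start \<mu> x i k)) = enat (block_start \<mu> x i m)"
  proof (rule antisym)
    show "(SUP k\<in>{k. enat k \<le> shape x i}. enat (block_start \<mu> x i k)) \<le> enat (block_start \<mu> x i m)"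
      by (rule SUP_least) (auto simp: assms block_start_def intro!: sum_mono2)
  qed (use assms in \<open>auto intro!: SUP_upper\<close>)
  then show ?thesis
    by (simp add: apply_morphism_def Let_def)
qed

text \<open>The letter \<open>x(n)\<close> is replaced by the block \<open>\<mu>(x(n))\<close>.\<close>

lemma apply_morphism_block:
  assumes wd: "image_well_defined \<mu> x" and n: "n \<in> box (shape x)"
    and r: "r \<in> box (shape (\<mu> (letter x n)))"
    and bdd: "\<And>i. shape (\<mu> (letter x n)) i \<noteq> \<infinity>"
  defines "p \<equiv> \<lambda>i. block_start \<mu> x i (n i) + r i"
  shows "p \<in> box (shape (apply_morphism \<mu> x))"
    and "letter (apply_morphism \<mu> x) p = letter (\<mu> (letter x n)) r"
proof -
  have width: "enat (block_width \<mu> x i (n i)) = shape (\<mu> (letter x n)) i" for i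
  proof -
    have "(\<lambda>_. 0)(i := n i) \<in> box (shape x)"
      using n by (rule axis_in_box)
    then have "shape (\<mu> (letter x ((\<lambda>_. 0)(i := n i)))) i = shape (\<mu> (letter x n)) i"
      using wd n unfolding image_well_defined_def by (metis fun_upd_same)
    then show ?thesis
      using bdd[of i] by (auto simp: block_width_def)
  qed
  have r_less: "r i < block_width \<mu> x i (n i)" for i
    using r width[of i] unfolding box_def by (metis (mono_tags, lifting) enat_ord_simps(2) mem_Collect_eq)
  have less: "p i < block_start \<mu> x i (Suc (n i))" for i
    using r_less[of i] by (simp add: p_def block_start_def)
  have mono: "block_start \<mu> x i k \<le> block_start \<mu> x i l" if "k \<le> l" for i k l
    using that by (auto simp: block_start_def intro!: sum_mono2)
  have index: "block_index \<mu> x i (p i) = n i" for i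
    unfolding block_index_def
  proof (rule Least_equality)
    fix m assume m: "p i < block_start \<mu> x i (Suc m)"
    show "n i \<le> m"
    proof (rule ccontr)
      assume "\<not> n i \<le> m"
      then have "block_start \<mu> x i (Suc m) \<le> block_start \<mu> x i (n i)"
        by (intro mono) simp
      with m show False by (simp add: p_def)
    qed
  qed (rule less)
  show p: "p \<in> box (shape (apply_morphism \<mu> x))"
  proof -
    have "enat (p i) < (SUP m\<in>{m. enat m \<le> shape x i}. enat (block_start \<mu> x i m))" for i
    proof -
      have "enat (Suc (n i)) \<le> shape x i"
        using n by (simp add: box_def Suc_ile_eq)
      then have "enat (block_start \<mu> x i (Suc (n i))) \<le>
          (SUP m\<in>{m. enat m \<le> shape x i}. enat (block_start \<mu> x i m))"
        by (intro SUP_upper) simp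
      moreover have "enat (p i) < enat (block_start \<mu> x i (Suc (n i)))"
        using less by simp
      ultimately show ?thesis by (rule less_le_trans[rotated])
    qed
    then show ?thesis by (simp add: apply_morphism_def Let_def box_def)
  qed
  then show "letter (apply_morphism \<mu> x) p = letter (\<mu> (letter x n)) r"
    by (simp add: apply_morphism_def Let_def index) (simp add: p_def)
qed

definition picture_prefix :: "('d, 'a) picture \<Rightarrow> ('d, 'a) picture \<Rightarrow> bool" where
  "picture_prefix x y \<longleftrightarrow> (\<forall>i. shape x i \<le> shape y i) \<and>
    (\<forall>p\<in>box (shape x). letter x p = letter y p)"

lemma box_mono: "(\<And>i. s i \<le> t i) \<Longrightarrow> box s \<subseteq> box t"
  unfolding box_def using less_le_trans by blast

lemma picture_prefix_box: "picture_prefix x y \<Longrightarrow> box (shape x) \<subseteq> box (shape y)"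
  by (rule box_mono) (simp add: picture_prefix_def)

lemma block_index_less:
  assumes "enat p < shape (apply_morphism \<mu> x) i"
  shows "enat (block_index \<mu> x i p) < shape x i"
    and "p < block_start \<mu> x i (Suc (block_index \<mu> x i p))"
    and "block_start \<mu> x i (block_index \<mu> x i p) \<le> p"
proof -
  have "enat p < (SUP m\<in>{m. enat m \<le> shape x i}. enat (block_start \<mu> x i m))"
    using assms by (simp add: apply_morphism_def Let_def)
  then obtain m where m: "enat m \<le> shape x i" "p < block_start \<mu> x i m"
    by (auto simp: less_SUP_iff)
  then obtain k where k: "m = Suc k"
    by (cases m) (auto simp: block_start_def)
  have "block_index \<mu> x i p \<le> k"
    unfolding block_index_def using m k by (intro Least_le) simp
  then show "enat (block_index \<mu> x i p) < shape x i"
    using m(1) k by (cases "shape x i") auto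
  show "p < block_start \<mu> x i (Suc (block_index \<mu> x i p))"
    unfolding block_index_def
    by (rule LeastI[of "\<lambda>m. p < block_start \<mu> x i (Suc m)" k]) (use m k in simp)
  show "block_start \<mu> x i (block_index \<mu> x i p) \<le> p"
  proof (cases "block_index \<mu> x i p")
    case 0
    then show ?thesis by (simp add: block_start_def)
  next
    case (Suc l)
    then have "\<not> p < block_start \<mu> x i (Suc l)"
      using not_less_Least[of l "\<lambda>m. p < block_start \<mu> x i (Suc m)"]
      unfolding block_index_def by simp
    with Suc show ?thesis by simp
  qed
qed

lemma apply_morphism_in_bounded_pictures:
  fixes \<mu> :: "'a \<Rightarrow> ('d, 'b) picture"
  assumes \<mu>: "\<mu> \<in> \<Xi> \<rightarrow> bounded_pictures \<Xi>'" and x: "x \<in> bounded_pictures \<Xi>"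
    and wd: "image_well_defined \<mu> x"
  shows "apply_morphism \<mu> x \<in> bounded_pictures \<Xi>'"
proof -
  have bdd: "shape (apply_morphism \<mu> x) i \<noteq> \<infinity>" for i
  proof -
    obtain m where "shape x i = enat m"
      using x unfolding bounded_pictures_def by (cases "shape x i") (simp, blast)
    then show ?thesis by (simp add: shape_apply_morphism_finite)
  qed
  have block: "\<exists>n r. n \<in> box (shape x) \<and> r \<in> box (shape (\<mu> (letter x n))) \<and>
      p = (\<lambda>i. block_start \<mu> x i (n i) + r i)"
    if p: "p \<in> box (shape (apply_morphism \<mu> x))" for p
  proof (intro exI conjI)
    define n where "n = (\<lambda>i. block_index \<mu> x i (p i))"
    define r where "r = (\<lambda>i. p i - block_start \<mu> x i (n i))"
    have p': "enat (p i) < shape (apply_morphism \<mu> x) i" for i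
      using p by (simp add: box_def)
    show n: "n \<in> box (shape x)"
      using block_index_less(1)[OF p'] by (simp add: box_def n_def)
    show "p = (\<lambda>i. block_start \<mu> x i (n i) + r i)"
      using block_index_less(3)[OF p'] by (auto simp: n_def r_def fun_eq_iff)
    have "enat (r i) < shape (\<mu> (letter x n)) i" for i
    proof -
      have axis: "(\<lambda>_. 0)(i := n i) \<in> box (shape x)"
        using n by (rule axis_in_box)
      have eq: "shape (\<mu> (letter x ((\<lambda>_. 0)(i := n i)))) i = shape (\<mu> (letter x n)) i"
        using wd n axis unfolding image_well_defined_def by (metis fun_upd_same)
      have "letter x n \<in> \<Xi>"
        using x n by (auto simp: bounded_pictures_def pictures_def)
      then have "shape (\<mu> (letter x n)) i \<noteq> \<infinity>"
        using \<mu> by (auto simp: bounded_pictures_def)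
      moreover have "r i < block_width \<mu> x i (n i)"
        using block_index_less(2,3)[OF p', of i] by (simp add: r_def n_def block_start_def)
      ultimately show ?thesis
        by (auto simp: block_width_def eq)
    qed
    then show "r \<in> box (shape (\<mu> (letter x n)))" by (simp add: box_def)
  qed
  have in_\<Xi>': "letter (apply_morphism \<mu> x) p \<in> \<Xi>'"
    if p: "p \<in> box (shape (apply_morphism \<mu> x))" for p
  proof -
    obtain n r where n: "n \<in> box (shape x)" and r: "r \<in> box (shape (\<mu> (letter x n)))"
      and p_eq: "p = (\<lambda>i. block_start \<mu> x i (n i) + r i)"
      using block[OF p] by blast
    have "letter x n \<in> \<Xi>"
      using x n by (auto simp: bounded_pictures_def pictures_def)
    then have b: "\<mu> (letter x n) \<in> bounded_pictures \<Xi>'" using \<mu> by blast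
    then have "letter (apply_morphism \<mu> x) p = letter (\<mu> (letter x n)) r"
      unfolding p_eq by (intro apply_morphism_block(2)[OF wd n r]) (auto simp: bounded_pictures_def)
    then show ?thesis
      using b r by (auto simp: bounded_pictures_def pictures_def)
  qed
  have zero: "shape (apply_morphism \<mu> x) j = 0" if i: "shape (apply_morphism \<mu> x) i = 0" for i j
  proof (rule ccontr)
    assume j: "shape (apply_morphism \<mu> x) j \<noteq> 0"
    then have j0: "enat 0 < shape (apply_morphism \<mu> x) j" by (simp add: zero_enat_def[symmetric])
    define n where "n = (\<lambda>_. 0)(j := block_index \<mu> x j 0)"
    have "shape x j > 0" using block_index_less(1)[OF j0]
      by (metis not_gr_zero not_less_zero)
    then have pos: "shape x k > 0" for k
      using x by (auto simp: bounded_pictures_def pictures_def)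
    have n: "n \<in> box (shape x)"
      using block_index_less(1)[OF j0] pos by (auto simp: n_def box_def zero_enat_def[symmetric])
    have "letter x n \<in> \<Xi>"
      using x n by (auto simp: bounded_pictures_def pictures_def)
    then have b: "\<mu> (letter x n) \<in> bounded_pictures \<Xi>'" using \<mu> by blast
    have "block_width \<mu> x j (block_index \<mu> x j 0) > 0"
      using block_index_less(2,3)[OF j0] by (simp add: block_start_def)
    then have "shape (\<mu> (letter x n)) j > 0"
      by (cases "shape (\<mu> (letter x n)) j = 0") (simp_all add: block_width_def n_def the_enat_0)
    then have "\<forall>k. shape (\<mu> (letter x n)) k > 0"
      using b by (auto simp: bounded_pictures_def pictures_def)
    then have "(\<lambda>_. 0) \<in> box (shape (\<mu> (letter x n)))"
      by (simp add: box_def zero_enat_def[symmetric])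
    from apply_morphism_block(1)[OF wd n this] b i show False
      by (auto simp: bounded_pictures_def box_def) (metis not_less_zero)
  qed
  have "letter (apply_morphism \<mu> x) \<in> extensional (box (shape (apply_morphism \<mu> x)))"
    by (simp add: apply_morphism_def Let_def)
  with in_\<Xi>' have "letter (apply_morphism \<mu> x) \<in> box (shape (apply_morphism \<mu> x)) \<rightarrow>\<^sub>E \<Xi>'"
    by (simp add: PiE_def)
  moreover have "(\<forall>i. shape (apply_morphism \<mu> x) i > 0) \<or> (\<forall>i. shape (apply_morphism \<mu> x) i = 0)"
    using zero by (metis not_gr_zero)
  ultimately show ?thesis
    using bdd by (simp add: bounded_pictures_def pictures_def)
qed

lemma morphism_power_in_bounded_pictures:
  assumes "multidim_morphism \<Xi> \<mu>" "b \<in> \<Xi>"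
  shows "morphism_power \<mu> n b \<in> bounded_pictures \<Xi>"
proof (induction n)
  case 0
  show ?case
    using assms(2) by (auto simp: letter_picture_def bounded_pictures_def pictures_def one_enat_def)
next
  case (Suc n)
  have "image_well_defined \<mu> (morphism_power \<mu> n b)"
    using assms unfolding multidim_morphism_def by (metis diff_Suc_1 le_add1 plus_1_eq_Suc)
  moreover have "\<mu> \<in> \<Xi> \<rightarrow> bounded_pictures \<Xi>"
    using assms(1) by (simp add: multidim_morphism_def)
  ultimately show ?case
    using Suc by (simp add: apply_morphism_in_bounded_pictures)
qed

lemma apply_morphism_prefix:
  fixes \<mu> :: "'a \<Rightarrow> ('d, 'b) picture"
  assumes xy: "picture_prefix x y" and x: "x \<in> pictures \<Xi>"
  shows "picture_prefix (apply_morphism \<mu> x) (apply_morphism \<mu> y)"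
proof -
  have width: "block_width \<mu> x i k = block_width \<mu> y i k" if k: "enat k < shape x i" for i k
  proof -
    have "shape x j > 0" for j
      using k x unfolding pictures_def
      by (metis (mono_tags, lifting) mem_Collect_eq not_less_zero)
    then have "(\<lambda>_. 0)(i := k) \<in> box (shape x)"
      using k by (auto simp: box_def zero_enat_def[symmetric])
    then show ?thesis
      using xy by (simp add: block_width_def picture_prefix_def)
  qed
  have start: "block_start \<mu> x i m = block_start \<mu> y i m" if "enat m \<le> shape x i" for i m
    unfolding block_start_def
  proof (rule sum.cong)
    fix k assume "k \<in> {..<m}"
    then have "enat k < enat m" by simp
    then have "enat k < shape x i" using that by (rule less_le_trans)
    then show "block_width \<mu> x i k = block_width \<mu> y i k" by (rule width)
  qed simp
  have le: "shape x i \<le> shape y i" for i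
    using xy by (simp add: picture_prefix_def)
  have shape_le: "shape (apply_morphism \<mu> x) i \<le> shape (apply_morphism \<mu> y) i" for i
    unfolding apply_morphism_def Let_def picture.sel
  proof (rule SUP_mono)
    fix m assume "m \<in> {m. enat m \<le> shape x i}"
    then have m: "enat m \<le> shape x i" by simp
    then have "m \<in> {m. enat m \<le> shape y i}" using le[of i] by simp
    moreover have "enat (block_start \<mu> x i m) \<le> enat (block_start \<mu> y i m)"
      using start[OF m] by simp
    ultimately show "\<exists>m'\<in>{m. enat m \<le> shape y i}.
        enat (block_start \<mu> x i m) \<le> enat (block_start \<mu> y i m')" by blast
  qed
  have "letter (apply_morphism \<mu> x) p = letter (apply_morphism \<mu> y) p"
    if p: "p \<in> box (shape (apply_morphism \<mu> x))" for p
  proof -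
    have p': "enat (p i) < shape (apply_morphism \<mu> x) i" for i
      using p by (simp add: box_def)
    define n where "n = (\<lambda>i. block_index \<mu> x i (p i))"
    have n_eq: "block_index \<mu> x i (p i) = n i" for i
      by (simp add: n_def)
    have n_less: "enat (n i) < shape x i" for i
      using block_index_less(1)[OF p'] by (simp add: n_def)
    have index: "block_index \<mu> y i (p i) = n i" for i
      unfolding block_index_def
    proof (rule Least_equality)
      show "p i < block_start \<mu> y i (Suc (n i))"
        using block_index_less(2)[OF p', of i] n_less[of i]
        by (simp add: n_eq start[symmetric] Suc_ile_eq)
      fix m assume m: "p i < block_start \<mu> y i (Suc m)"
      show "n i \<le> m"
      proof (rule ccontr)
        assume "\<not> n i \<le> m"
        then have "Suc m \<le> n i" by simp
        then have "enat (Suc m) \<le> shape x i"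
          using n_less[of i] by (cases "shape x i") auto
        with m have "p i < block_start \<mu> x i (Suc m)" by (simp add: start)
        then have "n i \<le> m" unfolding n_def block_index_def by (rule Least_le)
        with \<open>\<not> n i \<le> m\<close> show False by simp
      qed
    qed
    have "p \<in> box (shape (apply_morphism \<mu> y))"
      using p shape_le box_mono by blast
    moreover have "letter x n = letter y n"
      using xy n_less by (simp add: picture_prefix_def box_def)
    moreover have "block_start \<mu> x i (n i) = block_start \<mu> y i (n i)" for i
      using n_less[of i] by (intro start) simp
    ultimately show ?thesis
      using p by (simp add: apply_morphism_def Let_def index n_eq)
  qed
  with shape_le show ?thesis by (simp add: picture_prefix_def)
qed

lemma apply_morphism_letter_picture:
  fixes \<mu> :: "'a \<Rightarrow> ('d, 'b) picture"
  assumes "\<mu> b \<in> bounded_pictures \<Xi>"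
  shows "apply_morphism \<mu> (letter_picture b) = \<mu> b"
proof -
  have wd: "image_well_defined \<mu> (letter_picture b)"
    by (simp add: image_well_defined_def letter_picture_def box_one)
  have 0: "(\<lambda>_. 0) \<in> box (shape (letter_picture b :: ('d, 'a) picture))"
    "letter (letter_picture b :: ('d, 'a) picture) (\<lambda>_. 0) = b"
    by (simp_all add: letter_picture_def box_one)
  have "block_start \<mu> (letter_picture b) i 1 = the_enat (shape (\<mu> b) i)" for i
    using 0(2) by (simp add: block_start_def block_width_def fun_upd_idem)
  moreover have "enat (the_enat (shape (\<mu> b) i)) = shape (\<mu> b) i" for i
    using assms by (cases "shape (\<mu> b) i") (simp_all add: bounded_pictures_def, metis enat.distinct(2))
  ultimately have shape: "shape (apply_morphism \<mu> (letter_picture b)) = shape (\<mu> b)"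
    by (intro ext, subst shape_apply_morphism_finite[where m = 1])
      (simp_all add: letter_picture_def one_enat_def)
  have letter: "letter (apply_morphism \<mu> (letter_picture b)) p = letter (\<mu> b) p" for p
  proof (cases "p \<in> box (shape (\<mu> b))")
    case True
    then show ?thesis
      using apply_morphism_block(2)[OF wd 0(1), of p] assms
      by (simp add: 0(2) bounded_pictures_def block_start_def)
  next
    case False
    moreover have "letter (\<mu> b) p = undefined"
      using False assms by (auto simp: bounded_pictures_def pictures_def)
    moreover have "letter (apply_morphism \<mu> (letter_picture b)) \<in>
        extensional (box (shape (apply_morphism \<mu> (letter_picture b))))"
      by (simp add: apply_morphism_def Let_def)
    ultimately show ?thesis
      by (simp add: shape extensional_def)
  qed
  show ?thesis
    using shape letter by (intro picture.expand) auto
qed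

lemma morphism_power_prefix:
  assumes "multidim_morphism \<Xi> \<mu>" "a \<in> \<Xi>" "prolongable \<mu> a"
  shows "picture_prefix (morphism_power \<mu> n a) (morphism_power \<mu> (Suc n) a)"
proof (induction n)
  case 0
  have "\<mu> a \<in> bounded_pictures \<Xi>"
    using assms by (auto simp: multidim_morphism_def)
  then have eq: "morphism_power \<mu> (Suc 0) a = \<mu> a"
    by (simp add: apply_morphism_letter_picture)
  have one_le: "1 \<le> k" if "k \<noteq> 0" for k :: enat
    using that by (cases k) (auto simp: one_enat_def zero_enat_def)
  show ?case
    using assms(3) unfolding eq
    by (auto simp: picture_prefix_def letter_picture_def prolongable_def box_one zero_in_box_iff
        one_le)
next
  case (Suc n)
  then show ?case
    using apply_morphism_prefix morphism_power_in_bounded_pictures[OF assms(1,2)]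
    by (fastforce simp: bounded_pictures_def)
qed

lemma morphism_power_prefix_limit:
  assumes "multidim_morphism \<Xi> \<mu>" "a \<in> \<Xi>" "prolongable \<mu> a"
  shows "picture_prefix (morphism_power \<mu> n a) (morphism_limit \<mu> a)"
proof -
  have trans: "picture_prefix x z" if "picture_prefix x y" "picture_prefix y z"
    for x y z :: "('b, 'a) picture"
  proof -
    have "box (shape x) \<subseteq> box (shape y)"
      using that(1) by (rule picture_prefix_box)
    then show ?thesis
      using that unfolding picture_prefix_def by (metis order_trans subsetD)
  qed
  have chain: "picture_prefix (morphism_power \<mu> m a) (morphism_power \<mu> n a)" if "m \<le> n" for m n
    using that
  proof (induction rule: dec_induct)
    case base
    show ?case by (simp add: picture_prefix_def)
  next
    case (step n)
    then show ?case using trans morphism_power_prefix[OF assms] by blast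
  qed
  have le: "shape (morphism_power \<mu> n a) i \<le> shape (morphism_limit \<mu> a) i" for i
    by (auto simp: morphism_limit_def Let_def intro: SUP_upper)
  have "letter (morphism_power \<mu> n a) p = letter (morphism_limit \<mu> a) p"
    if p: "p \<in> box (shape (morphism_power \<mu> n a))" for p
  proof -
    define m where "m = (LEAST n. p \<in> box (shape (morphism_power \<mu> n a)))"
    have m: "m \<le> n" "p \<in> box (shape (morphism_power \<mu> m a))"
      using p unfolding m_def by (auto intro: Least_le LeastI)
    have "p \<in> box (shape (morphism_limit \<mu> a))"
      using p le box_mono by blast
    then have "letter (morphism_limit \<mu> a) p = letter (morphism_power \<mu> m a) p"
      by (simp add: morphism_limit_def Let_def m_def)
    then show ?thesis
      using chain[OF m(1)] m(2) by (simp add: picture_prefix_def)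
  qed
  with le show ?thesis by (simp add: picture_prefix_def)
qed

end

theory Submission
  imports Defs "HOL-Library.Infinite_Set"
begin

text \<open>
  Both conditions amount to a \<^emph>\<open>block structure\<close>: a map \<open>S\<close> on positions such that the children
  of \<open>n\<close> are \<open>S n, \<dots>, S (n + 1) - 1\<close>, the same in all \<open>d\<close> directions, and a finite-valued
  word \<open>Y\<close> on \<open>\<nat>\<^sup>d\<close>, with \<open>x\<close> a coding of \<open>Y\<close>, whose letter at a tuple of positions determines
  the numbers of children in each direction and the letters at the tuples of children.

  From a shape-symmetric word, the words describing the paths from position \<open>0\<close> in the tree of
  children form a regular language (follow the letters on the diagonal), enumerated genealogically
  by the positions. Since the letter \<open>a\<close> reproduces itself at offset \<open>0\<close>, the padding symbol can be
  read as the digit \<open>0\<close>.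

  Conversely, let \<open>u\<^sub>q(k)\<close> be the number of words of length \<open>k\<close> accepted from the state \<open>q\<close> of an
  automaton for \<open>L\<close>. By Dickson's lemma there are lengths \<open>s < t\<close> such that \<open>u\<^sub>q(s) \<le> u\<^sub>q(t)\<close> for all
  \<open>q\<close>, and \<open>u\<^sub>q(s)\<close>, \<open>u\<^sub>q(t)\<close> are zero for the same \<open>q\<close>. For a prefix \<open>v\<close> leading to \<open>q\<close>, a monotone
  surjection from the \<open>u\<^sub>q(t)\<close> words of \<open>L\<close> of length \<open>|v| + t\<close> onto the \<open>u\<^sub>q(s)\<close> words of length
  \<open>|v| + s\<close> beginning with \<open>v\<close> defines parents. No position is childless, so that no erasing morphism
  arises. The letter of \<open>Y\<close> at a tuple records, for each word, the state reached before its last \<open>s\<close>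
  letters together with these letters, and the state of the given DFAO before the last \<open>s\<close> columns.
\<close>

subsection \<open>Ranks in strict orders\<close>

lemma rank_strict_mono:
  assumes "Relation.trans R" "irrefl R" "finite {y \<in> X. (y, x') \<in> R}" "x \<in> X" "(x, x') \<in> R"
  shows "card {y \<in> X. (y, x) \<in> R} < card {y \<in> X. (y, x') \<in> R}"
proof (rule psubset_card_mono)
  show "{y \<in> X. (y, x) \<in> R} \<subset> {y \<in> X. (y, x') \<in> R}"
  proof (rule psubsetI)
    show "{y \<in> X. (y, x) \<in> R} \<subseteq> {y \<in> X. (y, x') \<in> R}"
      using assms(1,5) by (blast dest: transD)
    have "x \<in> {y \<in> X. (y, x') \<in> R}" "x \<notin> {y \<in> X. (y, x) \<in> R}"
      using assms(2,4,5) by (auto simp: irrefl_def)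
    then show "{y \<in> X. (y, x) \<in> R} \<noteq> {y \<in> X. (y, x') \<in> R}" by blast
  qed
qed fact

lemma rank_inj_on:
  assumes "Relation.trans R" "irrefl R" "total_on X R" "\<And>x. x \<in> X \<Longrightarrow> finite {y \<in> X. (y, x) \<in> R}"
  shows "inj_on (\<lambda>x. card {y \<in> X. (y, x) \<in> R}) X"
proof (rule inj_onI, rule ccontr)
  fix x x' assume x: "x \<in> X" "x' \<in> X" and eq: "card {y \<in> X. (y, x) \<in> R} = card {y \<in> X. (y, x') \<in> R}"
    and "x \<noteq> x'"
  then have "(x, x') \<in> R \<or> (x', x) \<in> R"
    using assms(3) by (auto simp: total_on_def)
  then show False
    using rank_strict_mono[OF assms(1,2) assms(4)[OF x(2)] x(1)]
      rank_strict_mono[OF assms(1,2) assms(4)[OF x(1)] x(2)] eq by auto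
qed

lemma rank_bij_betw:
  assumes "Relation.trans R" "irrefl R" "total_on X R" "finite X"
  shows "bij_betw (\<lambda>x. card {y \<in> X. (y, x) \<in> R}) X {..<card X}"
proof -
  have inj: "inj_on (\<lambda>x. card {y \<in> X. (y, x) \<in> R}) X"
    using assms by (intro rank_inj_on) auto
  have "card {y \<in> X. (y, x) \<in> R} < card X" if "x \<in> X" for x
    using that assms(2,4) by (intro psubset_card_mono) (auto simp: irrefl_def)
  then have "(\<lambda>x. card {y \<in> X. (y, x) \<in> R}) ` X \<subseteq> {..<card X}" by auto
  then have "(\<lambda>x. card {y \<in> X. (y, x) \<in> R}) ` X = {..<card X}"
    using inj by (intro card_subset_eq) (simp_all add: card_image)
  with inj show ?thesis by (simp add: bij_betw_def)
qed

subsection \<open>Genealogical order\<close>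

text \<open>On words of equal length \<open>lenlex\<close> is lexicographic, so the first difference
  decides; irreflexivity of \<open>r\<close> excludes a strict comparison at a common
  letter.\<close>

lemma lenlex_append_iff:
  assumes "irrefl r" "length u = length u'" "length v = length v'"
  shows "(u @ v, u' @ v') \<in> lenlex r \<longleftrightarrow> (u, u') \<in> lenlex r \<or> (u = u' \<and> (v, v') \<in> lenlex r)"
  using assms(2)
proof (induction u u' rule: list_induct2)
  case (Cons a u b u')
  then show ?case
    using assms(1,3) by (auto simp: Cons_lenlex_iff irrefl_def)
qed simp

lemma total_on_lenlex:
  assumes "total_on \<Sigma> r"
  shows "total_on (lists \<Sigma>) (lenlex r)"
proof (rule total_onI)
  fix u v assume "u \<in> lists \<Sigma>" "v \<in> lists \<Sigma>" "u \<noteq> v"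
  then show "(u, v) \<in> lenlex r \<or> (v, u) \<in> lenlex r"
  proof (induction u arbitrary: v)
    case (Cons a u)
    then show ?case
      using assms by (cases v) (auto simp: Cons_lenlex_iff total_on_def)
  qed (simp)
qed

text \<open>Lets any increasing enumeration be recognised as \<open>rep\<close>: the predecessors of
  \<open>f m\<close> in \<open>L\<close> are exactly its \<open>m\<close> earlier values.\<close>

lemma rep_eqI:
  assumes r: "Relation.trans r" "irrefl r"
    and L: "L = range f" and f: "\<And>m n. m < n \<Longrightarrow> (f m, f n) \<in> lenlex r"
  shows "rep L r n = f n"
proof -
  have irrefl: "(w, w) \<notin> lenlex r" for w
    using r(2) by (intro lenlex_irreflexive) (auto simp: irrefl_def)
  have f_iff: "(f m, f n) \<in> lenlex r \<longleftrightarrow> m < n" for m n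
    using f irrefl lenlex_trans r(1) by (metis linorder_neqE_nat)
  then have inj: "inj f"
    using irrefl by (metis injI linorder_neqE_nat f)
  have "{v \<in> L. (v, f m) \<in> lenlex r} = f ` {..<m}" for m
    using f_iff by (auto simp: L)
  then have card: "card {v \<in> L. (v, f m) \<in> lenlex r} = m" for m
    using inj by (simp add: card_image inj_on_subset)
  show ?thesis
    unfolding rep_def using card by (intro the_equality) (auto simp: L)
qed

subsection \<open>Dickson's lemma\<close>

lemma incseq_subseq_nat:
  fixes g :: "nat \<Rightarrow> nat"
  obtains k where "strict_mono k" "incseq (\<lambda>n. g (k n))"
proof -
  obtain k where k: "strict_mono k" "monoseq (\<lambda>n. g (k n))"
    using seq_monosub[of g] by blast
  show thesis
  proof (cases "incseq (\<lambda>n. g (k n))")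
    case False
    then have dec: "decseq (\<lambda>n. g (k n))" using k(2) by (auto simp: monoseq_iff)
    \<comment> \<open>A decreasing sequence of naturals is constant from an index where its minimum
      is attained; shifted by that index it is also weakly increasing.\<close>
    obtain N where N: "\<And>n. g (k N) \<le> g (k n)"
      using ex_has_least_nat[of "\<lambda>_. True" 0 "\<lambda>n. g (k n)"] by auto
    have const: "g (k (N + n)) = g (k N)" for n
      using N[of "N + n"] decseqD[OF dec, of N "N + n"] by simp
    show ?thesis
    proof (rule that)
      show "strict_mono (\<lambda>n. k (N + n))" using k(1) by (simp add: strict_mono_def)
      show "incseq (\<lambda>n. g (k (N + n)))" by (simp add: const incseq_def)
    qed
  qed (use k in \<open>blast intro: that\<close>)
qed

text \<open>Coordinates are added one at a time: passing to a subsequence for the new coordinate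
  keeps the earlier ones monotone.\<close>

lemma dickson:
  fixes f :: "nat \<Rightarrow> 'q \<Rightarrow> nat"
  assumes "finite Q"
  shows "\<exists>h. strict_mono h \<and> (\<forall>q\<in>Q. incseq (\<lambda>n. f (h n) q))"
  using assms
proof (induction Q)
  case empty
  show ?case by (auto intro!: exI[of _ id] strict_mono_id)
next
  case (insert q Q)
  then obtain h where h: "strict_mono h" "\<And>p. p \<in> Q \<Longrightarrow> incseq (\<lambda>n. f (h n) p)" by blast
  obtain k where k: "strict_mono k" "incseq (\<lambda>n. f (h (k n)) q)"
    by (rule incseq_subseq_nat[of "\<lambda>n. f (h n) q"])
  have "incseq (\<lambda>n. f (h (k n)) p)" if "p \<in> Q" for p
    using h(2)[OF that] k(1) by (simp add: incseq_def strict_mono_less_eq)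
  then show ?case
    using h(1) k by (intro exI[of _ "\<lambda>n. h (k n)"]) (auto simp: strict_mono_def)
qed

subsection \<open>Fibres of monotone surjections\<close>

text \<open>\<open>S\<close> is the lower adjoint of \<open>par\<close>. Surjectivity makes every
  fibre nonempty, hence \<open>S\<close> strict; since \<open>par 1 = 0\<close>, position 0 has the
  two children 0 and 1.\<close>

lemma fibres_of_mono_surj:
  fixes par :: "nat \<Rightarrow> nat"
  assumes "mono par" "surj par" "\<And>n. 1 \<le> n \<Longrightarrow> par n < n"
  obtains S where "strict_mono S" "S 0 = 0" "2 \<le> S 1"
    "\<And>m k. par m = k \<longleftrightarrow> S k \<le> m \<and> m < S (Suc k)"
proof -
  define S where "S k = (LEAST m. k \<le> par m)" for k
  have S: "S k \<le> m \<longleftrightarrow> k \<le> par m" for k m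
  proof
    obtain m' where "par m' = k" using assms(2) by (metis surjD)
    then have "k \<le> par (S k)" unfolding S_def by (intro LeastI[of "\<lambda>m. k \<le> par m" m']) simp
    also assume "S k \<le> m"
    then have "par (S k) \<le> par m" by (rule monoD[OF assms(1)])
    finally show "k \<le> par m" .
  qed (simp add: S_def Least_le)
  have fibre: "par m = k \<longleftrightarrow> S k \<le> m \<and> m < S (Suc k)" for m k
    using S[of k m] S[of "Suc k" m] by linarith
  have "S k < S (Suc k)" for k
  proof -
    obtain m where "par m = k" using assms(2) by (metis surjD)
    then show ?thesis using fibre by (metis le_less_trans)
  qed
  moreover have "S 0 = 0" by (simp add: S_def)
  moreover have "2 \<le> S 1"
    using S[of 1 1] assms(3)[of 1] by simp
  ultimately show ?thesis
    using fibre by (intro that[of S]) (auto simp: strict_mono_Suc_iff)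
qed

text \<open>Meant for two fibres of a parent map that are translates of one set \<open>J\<close>:
  cardinality gives equal widths, and each left end is its offset plus the least element of
  \<open>J\<close>.\<close>

lemma translated_intervals:
  fixes a b a' b' x x' :: nat
  assumes I: "{a..<b} = (+) x ` J" and I': "{a'..<b'} = (+) x' ` J" and "a < b"
  shows "b - a = b' - a'" "a' + x = a + x'"
proof -
  have "card {a..<b} = card J" "card {a'..<b'} = card J"
    unfolding I I' by (simp_all add: card_image)
  then show "b - a = b' - a'" by simp
  with \<open>a < b\<close> have "a' < b'" by simp
  obtain j where j: "j \<in> J" "a = x + j" using I \<open>a < b\<close> by (metis atLeastLessThan_iff imageE order_refl)
  obtain j' where j': "j' \<in> J" "a' = x' + j'" using I' \<open>a' < b'\<close> by (metis atLeastLessThan_iff imageE order_refl)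
  have "x + j' \<in> {a..<b}" "x' + j \<in> {a'..<b'}" unfolding I I' using j j' by auto
  then show "a' + x = a + x'" using j j' by simp
qed

subsection \<open>Automata and padding\<close>

lemma foldl_to_nat:
  "foldl (\<lambda>q c. to_nat (\<delta> (from_nat q) c)) (to_nat q) w = to_nat (foldl \<delta> q w)"
  by (induction w arbitrary: q) simp_all

text \<open>\<open>regular\<close> admits only states in \<open>nat\<close>; encoding by
  \<open>to_nat\<close> allows any countable type of states.\<close>

lemma regularI:
  fixes q0 :: "'q::countable"
  assumes "finite Q" "q0 \<in> Q" "\<And>q c. q \<in> Q \<Longrightarrow> c \<in> \<Sigma> \<Longrightarrow> \<delta> q c \<in> Q" "F \<subseteq> Q"
    and "L = {w \<in> lists \<Sigma>. foldl \<delta> q0 w \<in> F}"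
  shows "regular \<Sigma> L"
  unfolding regular_def
  using assms
  by (intro exI[of _ "to_nat ` Q"] exI[of _ "to_nat q0"] exI[of _ "to_nat ` F"]
      exI[of _ "\<lambda>q c. to_nat (\<delta> (from_nat q) c)"])
    (auto simp: foldl_to_nat)

lemma automaticI:
  fixes q0 :: "'q::countable"
  assumes "finite Q" "q0 \<in> Q"
    and "\<And>q c. q \<in> Q \<Longrightarrow> c \<in> padded_alphabet \<Sigma> \<Longrightarrow> \<delta> q c \<in> Q"
    and "\<And>q. q \<in> Q \<Longrightarrow> \<tau> q \<in> \<Gamma>"
    and "\<And>n. \<tau> (foldl \<delta> q0 (pad (\<lambda>i. rep L r (n i)))) = x n"
  shows "automatic L \<Sigma> r \<Gamma> x"
  unfolding automatic_def
  using assms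
  by (intro exI[of _ "\<lparr>states = to_nat ` Q, init = to_nat q0,
      trans = \<lambda>q c. to_nat (\<delta> (from_nat q) c), out = \<lambda>q. \<tau> (from_nat q)\<rparr>"])
    (auto simp: is_dfao_def dfao_output_def foldl_to_nat)

section \<open>Padded tuples read from the right end\<close>

definition last_letter :: "'a list \<Rightarrow> 'a option" where
  "last_letter w = (if w = [] then None else Some (last w))"

text \<open>Columns are peeled off at the right end, where the words are aligned, so that appending
  one letter to each word is one step of the recursion. An exhausted word stays empty and
  contributes \<open>None\<close>.\<close>

primrec columns :: "nat \<Rightarrow> ('d \<Rightarrow> 'a list) \<Rightarrow> ('d \<Rightarrow> 'a option) list" where
  "columns 0 w = []"
| "columns (Suc m) w = columns m (\<lambda>i. butlast (w i)) @ [\<lambda>i. last_letter (w i)]"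

lemma columns_conv:
  assumes "\<And>i. length (w i) \<le> m"
  shows "columns m w =
    map (\<lambda>k i. (replicate (m - length (w i)) None @ map Some (w i)) ! k) [0..<m]"
  using assms
proof (induction m arbitrary: w)
  case (Suc m)
  have IH: "columns m (\<lambda>i. butlast (w i)) =
      map (\<lambda>k i. (replicate (m - (length (w i) - 1)) None @ map Some (butlast (w i))) ! k) [0..<m]"
    using Suc.IH[of "\<lambda>i. butlast (w i)"] Suc.prems by (simp add: le_diff_conv)
  have init: "(replicate (m - (length (w i) - 1)) None @ map Some (butlast (w i))) ! k
      = (replicate (Suc m - length (w i)) None @ map Some (w i)) ! k" if "k < m" for i k
  proof (cases "w i = []")
    case False
    then have "m - (length (w i) - 1) = Suc m - length (w i)"
      using Suc.prems[of i] by (cases "w i") auto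
    moreover have "k - (Suc m - length (w i)) < length (w i) - 1" if "\<not> k < Suc m - length (w i)"
      using that \<open>k < m\<close> False Suc.prems[of i] by (cases "w i") auto
    ultimately show ?thesis
      by (auto simp: nth_append nth_butlast)
  qed (use that in \<open>simp del: replicate.simps\<close>)
  have last: "last_letter (w i) = (replicate (Suc m - length (w i)) None @ map Some (w i)) ! m" for i
  proof (cases "w i = []")
    case False
    define j where "j = Suc m - length (w i)"
    have "m = j + (length (w i) - 1)"
      using False Suc.prems[of i] unfolding j_def by (cases "w i") auto
    then have "(replicate j None @ map Some (w i)) ! m = Some (last (w i))"
      using nth_append_length_plus[of "replicate j None" "map Some (w i)" "length (w i) - 1"] False
      by (simp add: last_conv_nth)
    then show ?thesis
      unfolding last_letter_def using False by (simp add: j_def)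
  qed (simp add: last_letter_def del: replicate.simps)
  have "map (\<lambda>k i. (replicate (m - (length (w i) - 1)) None @ map Some (butlast (w i))) ! k) [0..<m]
      = map (\<lambda>k i. (replicate (Suc m - length (w i)) None @ map Some (w i)) ! k) [0..<m]"
    by (rule map_cong[OF refl], rule ext, rule init) simp
  then show ?case
    unfolding columns.simps IH last upt_Suc_append[OF le0] map_append list.map by (rule arg_cong)
qed simp

lemma pad_conv_columns: "pad w = columns (Max (range (\<lambda>i. length (w i)))) w"
  by (simp add: pad_def Let_def columns_conv)

text \<open>
  The initial state \<^term>\<open>None\<close> absorbs blank columns, so the state reached does not depend on the
  amount of padding.
\<close>

definition skip_blank :: "('q \<Rightarrow> ('d \<Rightarrow> 'a option) \<Rightarrow> 'q) \<Rightarrow> 'q \<Rightarrow> 'q option \<Rightarrow> ('d \<Rightarrow> 'a option) \<Rightarrow> 'q option" where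
  "skip_blank \<delta> q\<^sub>0 p c = (case p of
     None \<Rightarrow> if c = (\<lambda>_. None) then None else Some (\<delta> q\<^sub>0 c)
   | Some q \<Rightarrow> Some (\<delta> q c))"

definition column_state ::
  "('q \<Rightarrow> ('d::finite \<Rightarrow> 'a option) \<Rightarrow> 'q) \<Rightarrow> 'q \<Rightarrow> ('d \<Rightarrow> 'a list) \<Rightarrow> 'q option" where
  "column_state \<delta> q\<^sub>0 w = foldl (skip_blank \<delta> q\<^sub>0) None (pad w)"

text \<open>A word of maximal length gets no padding and shows a letter in the first column.\<close>

lemma hd_pad_nonblank:
  assumes "pad w = c # cs"
  shows "c \<noteq> (\<lambda>_. None)"
proof -
  define m where "m = Max (range (\<lambda>i. length (w i)))"
  have "m \<in> range (\<lambda>i. length (w i))"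
    unfolding m_def by (rule Max_in) auto
  then obtain i where i: "length (w i) = m" by auto
  have "length (pad w) = m" by (simp add: pad_def m_def Let_def)
  then have "0 < m" using assms by auto
  have "c = pad w ! 0" by (simp add: assms)
  moreover have "(pad w ! 0) i = Some (w i ! 0)"
    using \<open>0 < m\<close> i by (simp add: pad_def m_def[symmetric] Let_def)
  ultimately show ?thesis by auto
qed

text \<open>A nonempty padded tuple starts with a nonblank column, so \<open>skip_blank\<close>
  leaves \<open>None\<close> at once and then follows \<open>\<delta>\<close>.\<close>

lemma foldl_pad:
  "foldl \<delta> q\<^sub>0 (pad w) = (case column_state \<delta> q\<^sub>0 w of None \<Rightarrow> q\<^sub>0 | Some q \<Rightarrow> q)"
proof -
  have Some: "foldl (skip_blank \<delta> q\<^sub>0) (Some q) cs = Some (foldl \<delta> q cs)" for q cs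
    by (induction cs arbitrary: q) (simp_all add: skip_blank_def)
  show ?thesis
  proof (cases "pad w")
    case (Cons c cs)
    then show ?thesis
      using hd_pad_nonblank[OF Cons] Some by (simp add: column_state_def skip_blank_def[of _ _ None])
  qed (simp add: column_state_def)
qed

text \<open>The extra column is a blank one at the left end, absorbed by \<open>None\<close>; the
  induction reaches it by stripping columns at the right.\<close>

lemma foldl_skip_blank_columns_Suc:
  assumes "\<And>i. length (w i) \<le> m"
  shows "foldl (skip_blank \<delta> q\<^sub>0) None (columns (Suc m) w)
    = foldl (skip_blank \<delta> q\<^sub>0) None (columns m w)"
  using assms
proof (induction m arbitrary: w)
  case 0
  then show ?case by (simp add: skip_blank_def last_letter_def)
next
  case (Suc m)
  have "length (butlast (w i)) \<le> m" for i
    using Suc.prems[of i] by simp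
  then have "foldl (skip_blank \<delta> q\<^sub>0) None (columns (Suc m) (\<lambda>i. butlast (w i)))
      = foldl (skip_blank \<delta> q\<^sub>0) None (columns m (\<lambda>i. butlast (w i)))"
    by (rule Suc.IH)
  then show ?case
    unfolding columns.simps(2)[of "Suc m" w] columns.simps(2)[of m w] foldl_append by (rule arg_cong)
qed

lemma column_state_columns:
  assumes "\<And>i. length (w i) \<le> m"
  shows "foldl (skip_blank \<delta> q\<^sub>0) None (columns m w) = column_state \<delta> q\<^sub>0 w"
proof -
  define k where "k = Max (range (\<lambda>i. length (w i)))"
  have k: "length (w i) \<le> k" for i by (simp add: k_def)
  have "k \<le> m" using assms by (simp add: k_def)
  then have "foldl (skip_blank \<delta> q\<^sub>0) None (columns m w) = foldl (skip_blank \<delta> q\<^sub>0) None (columns k w)"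
  proof (induction rule: dec_induct)
    case (step n)
    have "length (w i) \<le> n" for i using k[of i] step.hyps(1) by simp
    then show ?case using step.IH by (intro trans[OF foldl_skip_blank_columns_Suc])
  qed simp
  then show ?thesis by (simp add: column_state_def pad_conv_columns k_def)
qed

text \<open>Removing last letters may change the maximal length. Independence of the amount of
  padding lets both sides be computed from a common bound \<open>m\<close>.\<close>

lemma column_state_step:
  "column_state \<delta> q\<^sub>0 w =
    skip_blank \<delta> q\<^sub>0 (column_state \<delta> q\<^sub>0 (\<lambda>i. butlast (w i))) (\<lambda>i. last_letter (w i))"
proof -
  define m where "m = Max (range (\<lambda>i. length (w i)))"
  have m: "length (w i) \<le> m" for i by (simp add: m_def)
  have "column_state \<delta> q\<^sub>0 w = foldl (skip_blank \<delta> q\<^sub>0) None (columns (Suc m) w)"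
    using m by (intro column_state_columns[symmetric] le_SucI)
  also have "\<dots> = skip_blank \<delta> q\<^sub>0
      (foldl (skip_blank \<delta> q\<^sub>0) None (columns m (\<lambda>i. butlast (w i)))) (\<lambda>i. last_letter (w i))"
    by simp
  also have "foldl (skip_blank \<delta> q\<^sub>0) None (columns m (\<lambda>i. butlast (w i)))
      = column_state \<delta> q\<^sub>0 (\<lambda>i. butlast (w i))"
    using m by (intro column_state_columns) (simp add: le_diff_conv le_SucI)
  finally show ?thesis .
qed

text \<open>For a word shorter than \<open>k\<close> the truncated subtraction gives the empty word
  here and the whole word in \<open>take_end\<close>, in agreement with padding on the left.\<close>

definition drop_end :: "nat \<Rightarrow> 'a list \<Rightarrow> 'a list" where
  "drop_end k w = take (length w - k) w"

definition take_end :: "nat \<Rightarrow> 'a list \<Rightarrow> 'a list" where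
  "take_end k w = drop (length w - k) w"

lemma drop_end_append_take_end: "drop_end k w @ take_end k w = w"
  by (simp add: drop_end_def take_end_def)

lemma length_take_end: "length (take_end k w) = min k (length w)"
  by (auto simp: take_end_def)

lemma drop_end_append: "length z = k \<Longrightarrow> drop_end k (v @ z) = v"
  by (simp add: drop_end_def)

lemma take_end_append: "length z = k \<Longrightarrow> take_end k (v @ z) = z"
  by (simp add: take_end_def)

text \<open>The state before the last \<open>k\<close> columns and these columns determine the final
  state; the induction strips one letter of each word.\<close>

lemma column_state_cong:
  assumes "column_state \<delta> q\<^sub>0 (\<lambda>i. drop_end k (w i)) = column_state \<delta> q\<^sub>0 (\<lambda>i. drop_end k (w' i))"
    and "\<And>i. take_end k (w i) = take_end k (w' i)"
  shows "column_state \<delta> q\<^sub>0 w = column_state \<delta> q\<^sub>0 w'"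
  using assms
proof (induction k arbitrary: w w')
  case 0
  then show ?case by (simp add: drop_end_def)
next
  case (Suc k)
  have drop: "drop_end (Suc k) u = drop_end k (butlast u)" for u :: "'c list"
    by (simp add: drop_end_def butlast_conv_take min_def)
  have take: "take_end k (butlast u) = butlast (take_end (Suc k) u)" for u :: "'c list"
    by (cases "u = []") (auto simp: take_end_def butlast_drop)
  have last: "last_letter u = last_letter (take_end (Suc k) u)" for u :: "'c list"
    by (cases u) (auto simp: last_letter_def take_end_def)
  have "column_state \<delta> q\<^sub>0 (\<lambda>i. butlast (w i)) = column_state \<delta> q\<^sub>0 (\<lambda>i. butlast (w' i))"
    using Suc.prems by - (rule Suc.IH, simp_all add: drop take)
  moreover have "last_letter (w i) = last_letter (w' i)" for i
    using Suc.prems(2)[of i] last by metis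
  ultimately show ?case
    by (simp add: column_state_step[of _ _ w] column_state_step[of _ _ w'])
qed

lemma column_state_closed:
  assumes \<delta>: "\<And>q c. q \<in> Q \<Longrightarrow> c \<in> padded_alphabet \<Sigma> \<Longrightarrow> \<delta> q c \<in> Q" and "q\<^sub>0 \<in> Q"
    and "\<And>i. w i \<in> lists \<Sigma>"
  shows "column_state \<delta> q\<^sub>0 w \<in> insert None (Some ` Q)"
proof -
  have "foldl (skip_blank \<delta> q\<^sub>0) None (columns m w) \<in> insert None (Some ` Q)"
    if "\<And>i. w i \<in> lists \<Sigma>" for m w
    using that
  proof (induction m arbitrary: w)
    case (Suc m)
    have "butlast (w i) \<in> lists \<Sigma>" for i
      using Suc.prems[of i] by (auto dest: in_set_butlastD)
    then have "foldl (skip_blank \<delta> q\<^sub>0) None (columns m (\<lambda>i. butlast (w i))) \<in> insert None (Some ` Q)"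
      by (rule Suc.IH)
    moreover have "(\<lambda>i. last_letter (w i)) \<in> padded_alphabet \<Sigma>"
      using Suc.prems by (auto simp: padded_alphabet_def last_letter_def in_lists_conv_set
          intro!: imageI last_in_set)
    moreover have "skip_blank \<delta> q\<^sub>0 p c \<in> insert None (Some ` Q)"
      if "p \<in> insert None (Some ` Q)" "c \<in> padded_alphabet \<Sigma>" for p c
      using that \<delta> \<open>q\<^sub>0 \<in> Q\<close> by (auto simp: skip_blank_def)
    ultimately show ?case
      by (simp only: columns.simps foldl_append foldl.simps)
  qed simp
  then show ?thesis
    using assms(3) by (simp add: column_state_def pad_conv_columns)
qed

lemma drop_end_drop_end: "drop_end k (drop_end l w) = drop_end (k + l) w"
  by (auto simp: drop_end_def min_def intro: arg_cong[of _ _ "\<lambda>n. take n w"])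

lemma take_end_drop_end: "take_end k (drop_end l w) = drop_end l (take_end (k + l) w)"
proof -
  have "length w - l - (length w - l - k) = length w - (length w - (k + l)) - l"
    "length w - l - k = length w - (k + l)" by linarith+
  then show ?thesis by (simp add: drop_end_def take_end_def drop_take)
qed

lemma take_end_take_end:
  assumes "l \<le> k"
  shows "take_end l (take_end k w) = take_end l w"
proof -
  have "length w - (length w - k) - l + (length w - k) = length w - l"
    using assms by linarith
  then show ?thesis by (simp add: take_end_def)
qed

subsection \<open>Self-similar words\<close>

definition subword :: "(('d \<Rightarrow> nat) \<Rightarrow> 'a) \<Rightarrow> ('d \<Rightarrow> nat) \<Rightarrow> ('d \<Rightarrow> nat) \<Rightarrow> ('d, 'a) picture" where
  "subword Y c e = Picture (\<lambda>i. enat (e i - c i))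
     (\<lambda>r\<in>box (\<lambda>i. enat (e i - c i)). Y (\<lambda>i. c i + r i))"

locale self_similar =
  fixes S :: "nat \<Rightarrow> nat" and Y :: "('d::finite \<Rightarrow> nat) \<Rightarrow> 'a" and \<mu> :: "'a \<Rightarrow> ('d, 'a) picture"
  assumes strict_mono: "strict_mono S" and S_0: "S 0 = 0"
    and morphism: "\<And>n. \<mu> (Y n) = subword Y (\<lambda>i. S (n i)) (\<lambda>i. S (Suc (n i)))"
begin

lemma S_le: "k \<le> l \<Longrightarrow> S k \<le> S l"
  using strict_mono by (simp add: strict_mono_less_eq)

lemma S_less: "k < l \<Longrightarrow> S k < S l"
  using strict_mono by (simp add: strict_mono_less)

lemma
  assumes "\<And>i. c i < e i"
  shows image_well_defined_subword: "image_well_defined \<mu> (subword Y c e)"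
    and apply_morphism_subword:
      "apply_morphism \<mu> (subword Y c e) = subword Y (\<lambda>i. S (c i)) (\<lambda>i. S (e i))"
proof -
  define x where "x = subword Y c e"
  have shape_x: "shape x i = enat (e i - c i)" for i
    by (simp add: x_def subword_def)
  have letter_x: "letter x n = Y (\<lambda>i. c i + n i)" if "n \<in> box (shape x)" for n
    using that by (simp add: x_def subword_def)
  have shape_block: "shape (\<mu> (letter x n)) i = enat (S (Suc (c i + n i)) - S (c i + n i))"
    if "n \<in> box (shape x)" for n i
    using that by (simp add: letter_x morphism) (simp add: subword_def)
  show wd: "image_well_defined \<mu> (subword Y c e)"
    unfolding x_def[symmetric] image_well_defined_def by (simp add: shape_block)
  have axis: "(\<lambda>_. 0)(i := k) \<in> box (shape x)" if "k < e i - c i" for i k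
    using that assms by (auto simp: box_def shape_x)
  have width: "block_width \<mu> x i k = S (Suc (c i + k)) - S (c i + k)" if "k < e i - c i" for i k
    by (simp add: block_width_def shape_block[OF axis[OF that]])
  \<comment> \<open>Block widths are differences of consecutive values of \<open>S\<close>, so their
    sum telescopes.\<close>
  have start: "block_start \<mu> x i k = S (c i + k) - S (c i)" if "k \<le> e i - c i" for i k
    using that
  proof (induction k)
    case (Suc k)
    have "block_start \<mu> x i (Suc k) = block_start \<mu> x i k + block_width \<mu> x i k"
      by (simp add: block_start_def)
    then show ?case
      using Suc width[of k i] S_le[of "c i" "c i + k"] S_le[of "c i + k" "Suc (c i + k)"] by simp
  qed (simp add: block_start_def)
  have shape: "shape (apply_morphism \<mu> x) i = enat (S (e i) - S (c i))" for i
    using shape_apply_morphism_finite[OF shape_x, of \<mu> i] start[of "e i - c i" i] assms[of i]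
    by simp
  have letter: "letter (apply_morphism \<mu> x) p = Y (\<lambda>i. S (c i) + p i)"
    if p: "p \<in> box (shape (apply_morphism \<mu> x))" for p
  proof -
    define n where "n = (\<lambda>i. block_index \<mu> x i (p i))"
    define r where "r = (\<lambda>i. p i - block_start \<mu> x i (n i))"
    have p': "enat (p i) < shape (apply_morphism \<mu> x) i" for i
      using p by (simp add: box_def)
    note index = block_index_less[OF p', folded n_def]
    have n: "n i < e i - c i" for i
      using index(1)[of i] by (simp add: shape_x n_def)
    then have n_box: "n \<in> box (shape x)"
      by (simp add: box_def shape_x)
    have p_eq: "p i = block_start \<mu> x i (n i) + r i" for i
      using index(3)[of i] by (simp add: r_def n_def)
    have r: "r i < S (Suc (c i + n i)) - S (c i + n i)" for i
      using index(2,3)[of i] n[of i] width[OF n, of i] by (simp add: r_def n_def block_start_def)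
    have "letter (apply_morphism \<mu> x) p = letter (\<mu> (letter x n)) r"
      using apply_morphism_block(2)[OF wd[folded x_def] n_box, of r] r
      by (simp add: shape_block[OF n_box] box_def p_eq[symmetric])
    also have "\<dots> = Y (\<lambda>i. S (c i + n i) + r i)"
      using r by (simp add: letter_x[OF n_box] morphism) (simp add: subword_def box_def)
    also have "(\<lambda>i. S (c i + n i) + r i) = (\<lambda>i. S (c i) + p i)"
    proof
      fix i
      have "S (c i) \<le> S (c i + n i)" by (rule S_le) simp
      then show "S (c i + n i) + r i = S (c i) + p i"
        using start[of "n i" i] n[of i] by (simp add: p_eq[of i])
    qed
    finally show ?thesis .
  qed
  have "letter (apply_morphism \<mu> x) \<in> extensional (box (shape (apply_morphism \<mu> x)))"
    by (simp add: apply_morphism_def Let_def)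
  with letter have "letter (apply_morphism \<mu> x) =
      (\<lambda>p\<in>box (shape (apply_morphism \<mu> x)). Y (\<lambda>i. S (c i) + p i))"
    by (auto simp: extensional_def)
  moreover have "shape (apply_morphism \<mu> x) = (\<lambda>i. enat (S (e i) - S (c i)))"
    using shape by auto
  ultimately show "apply_morphism \<mu> (subword Y c e) = subword Y (\<lambda>i. S (c i)) (\<lambda>i. S (e i))"
    unfolding x_def[symmetric] by (intro picture.expand) (simp add: subword_def)
qed

lemma morphism_power_subword:
  "morphism_power \<mu> m (Y n) = subword Y (\<lambda>i. (S ^^ m) (n i)) (\<lambda>i. (S ^^ m) (Suc (n i)))"
proof (induction m)
  case 0
  show ?case
    by (simp add: letter_picture_def subword_def one_enat_def)
      (intro restrict_ext, simp add: box_def)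
next
  case (Suc m)
  have "(S ^^ m) (n i) < (S ^^ m) (Suc (n i))" for i
    by (induction m) (simp_all add: S_less)
  then show ?case
    by (simp add: Suc apply_morphism_subword)
qed

lemma subword_bounded:
  assumes "\<And>i. c i < e i" "range Y \<subseteq> \<Xi>"
  shows "subword Y c e \<in> bounded_pictures \<Xi>"
  using assms
  by (auto simp: bounded_pictures_def pictures_def subword_def zero_enat_def)

lemma multidim_morphism: "multidim_morphism (range Y) \<mu>"
  unfolding multidim_morphism_def
proof (intro conjI ballI allI impI)
  show "\<mu> \<in> range Y \<rightarrow> bounded_pictures (range Y)"
    by (auto simp: morphism S_less intro!: subword_bounded)
  fix b :: 'a and m :: nat assume "b \<in> range Y"
  then obtain n where b: "b = Y n" by blast
  have less: "(S ^^ m) (n i) < (S ^^ m) (Suc (n i))" for m i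
    by (induction m) (simp_all add: S_less)
  show "image_well_defined \<mu> (morphism_power \<mu> (m - 1) b)"
    unfolding b morphism_power_subword by (rule image_well_defined_subword[OF less])
qed

lemma prolongable: "prolongable \<mu> (Y (\<lambda>_. 0))"
proof -
  have "S 0 < S (Suc 0)" by (simp add: S_less)
  then show ?thesis
    by (auto simp: prolongable_def morphism subword_def box_def S_0)
qed

text \<open>Since \<open>k < S k\<close> for positive \<open>k\<close>, the value
  \<open>(S ^^ m) 1\<close> exceeds \<open>m\<close>. The \<open>m\<close>th power of the morphism
  on the origin letter is the part of \<open>Y\<close> in the cube of that side, so these cubes
  exhaust all positions.\<close>

lemma
  assumes "2 \<le> S 1"
  shows infinite_word_limit: "infinite_word (morphism_limit \<mu> (Y (\<lambda>_. 0)))"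
    and letter_limit: "letter (morphism_limit \<mu> (Y (\<lambda>_. 0))) n = Y n"
proof -
  define y where "y = morphism_limit \<mu> (Y (\<lambda>_. 0))"
  have 0: "(S ^^ m) 0 = 0" for m
    by (induction m) (simp_all add: S_0)
  have grow: "k < S k" if "1 \<le> k" for k
    using that
  proof (induction k rule: nat_induct_at_least)
    case (Suc k)
    then show ?case using S_less[of k "Suc k"] by simp
  qed (use assms in simp)
  have large: "m < (S ^^ m) 1" for m
  proof (induction m)
    case (Suc m)
    then show ?case using grow[of "(S ^^ m) 1"] by simp
  qed simp
  have prefix: "picture_prefix (morphism_power \<mu> m (Y (\<lambda>_. 0))) y" for m
    unfolding y_def by (rule morphism_power_prefix_limit[OF multidim_morphism _ prolongable]) simp
  have "enat m \<le> shape y i" for m i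
  proof -
    have "enat m \<le> enat ((S ^^ m) 1)" using large[of m] by simp
    also have "\<dots> \<le> shape y i"
      using prefix[of m] by (simp add: picture_prefix_def morphism_power_subword subword_def 0)
    finally show ?thesis .
  qed
  then have shape_y: "shape y i = \<infinity>" for i
    by (metis Suc_ile_eq less_irrefl not_infinity_eq)
  then show "infinite_word (morphism_limit \<mu> (Y (\<lambda>_. 0)))"
    by (simp add: infinite_word_def y_def)
  define m where "m = Max (range n)"
  have m: "n i \<le> m" for i
    by (simp add: m_def)
  have "n \<in> box (shape (morphism_power \<mu> m (Y (\<lambda>_. 0))))"
    using m large[of m]
    by (simp add: box_def morphism_power_subword subword_def 0) (meson le_less_trans)
  then have "letter y n = letter (morphism_power \<mu> m (Y (\<lambda>_. 0))) n"
    using prefix[of m] by (simp add: picture_prefix_def)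
  also have "\<dots> = Y n"
    using \<open>n \<in> box _\<close> by (simp add: morphism_power_subword subword_def 0)
  finally show "letter (morphism_limit \<mu> (Y (\<lambda>_. 0))) n = Y n"
    by (simp add: y_def)
qed

end

text \<open>The morphism expands a letter at some chosen position carrying it; \<open>width\<close>
  and \<open>child\<close> make the block independent of the choice. The injection \<open>g\<close>
  moves the alphabet into \<open>nat\<close>.\<close>

lemma ex_morphism_of_self_similar:
  fixes x :: "('d::finite \<Rightarrow> nat) \<Rightarrow> 'g" and Y :: "('d \<Rightarrow> nat) \<Rightarrow> 'b"
  assumes S: "strict_mono S" "S 0 = 0" "2 \<le> S 1" and fin: "finite (range Y)"
    and width: "\<And>m n i. Y m = Y n \<Longrightarrow> S (Suc (m i)) - S (m i) = S (Suc (n i)) - S (n i)"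
    and child: "\<And>m n r. Y m = Y n \<Longrightarrow> (\<And>i. r i < S (Suc (m i)) - S (m i)) \<Longrightarrow>
      Y (\<lambda>i. S (m i) + r i) = Y (\<lambda>i. S (n i) + r i)"
    and coding: "\<And>m n. Y m = Y n \<Longrightarrow> x m = x n"
    and \<Gamma>: "range x \<subseteq> \<Gamma>"
  shows "\<exists>(\<Xi> :: nat set) (\<mu> :: nat \<Rightarrow> ('d, nat) picture) a \<nu>.
            finite \<Xi> \<and> multidim_morphism \<Xi> \<mu> \<and> a \<in> \<Xi> \<and> prolongable \<mu> a \<and>
            infinite_word (morphism_limit \<mu> a) \<and>
            shape_symmetric \<mu> (morphism_limit \<mu> a) \<and>
            \<nu> \<in> \<Xi> \<rightarrow> \<Gamma> \<and> (\<forall>n. x n = \<nu> (letter (morphism_limit \<mu> a) n))"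
proof -
  obtain g :: "'b \<Rightarrow> nat" where g: "inj_on g (range Y)"
    using finite_imp_inj_to_nat_seg[OF fin] by blast
  define Z where "Z n = g (Y n)" for n
  have Z_eq: "Z m = Z n \<longleftrightarrow> Y m = Y n" for m n
    using g by (auto simp: Z_def inj_on_def)
  define \<mu> where "\<mu> b = (let n = SOME n. Z n = b
      in subword Z (\<lambda>i. S (n i)) (\<lambda>i. S (Suc (n i))))" for b
  have "\<mu> (Z n) = subword Z (\<lambda>i. S (n i)) (\<lambda>i. S (Suc (n i)))" for n
  proof -
    define m where "m = (SOME m. Z m = Z n)"
    have m: "Y m = Y n"
      unfolding m_def Z_eq[symmetric] by (rule someI[of "\<lambda>m. Z m = Z n" n]) simp
    have "\<mu> (Z n) = subword Z (\<lambda>i. S (m i)) (\<lambda>i. S (Suc (m i)))"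
      by (simp add: \<mu>_def m_def Let_def)
    also have "\<dots> = subword Z (\<lambda>i. S (n i)) (\<lambda>i. S (Suc (n i)))"
      using width[OF m] child[OF m] by (auto simp: subword_def Z_def box_def intro!: restrict_ext)
    finally show ?thesis .
  qed
  then interpret self_similar S Z \<mu>
    using S by unfold_locales auto
  define \<nu> where "\<nu> b = x (SOME n. Z n = b)" for b
  have \<nu>: "\<nu> (Z n) = x n" for n
    unfolding \<nu>_def by (rule coding) (metis (mono_tags, lifting) Z_eq someI)
  have "finite (range Z)"
    using fin unfolding Z_def by (simp add: image_image[symmetric, of g Y])
  \<comment> \<open>The width in direction \<open>i\<close> depends on \<open>n i\<close> alone,
    through the same \<open>S\<close> for all \<open>i\<close>; permuting coordinates therefore
    permutes widths.\<close>
  moreover have "shape_symmetric \<mu> (morphism_limit \<mu> (Z (\<lambda>_. 0)))"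
    using S by (simp add: shape_symmetric_def letter_limit morphism) (simp add: subword_def)
  moreover have "\<nu> \<in> range Z \<rightarrow> \<Gamma>"
    using \<Gamma> \<nu> by auto
  ultimately show ?thesis
    using multidim_morphism prolongable infinite_word_limit letter_limit[OF S(3)] S(3) \<nu>
    by (intro exI[of _ "range Z"] exI[of _ \<mu>] exI[of _ "Z (\<lambda>_. 0)"] exI[of _ \<nu>]) simp
qed

subsection \<open>Addresses in a block structure\<close>

definition parent :: "(nat \<Rightarrow> nat) \<Rightarrow> nat \<Rightarrow> nat" where
  "parent S p = (LEAST k. p < S (Suc k))"

text \<open>
  The condition \<^term>\<open>parent S p < p\<close> holds for all \<open>p \<ge> 1\<close> in the locale below; it makes the
  recursion terminate for arbitrary \<open>S\<close>.
\<close>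

fun address :: "(nat \<Rightarrow> nat) \<Rightarrow> nat \<Rightarrow> nat list" where
  "address S p = (if parent S p < p then address S (parent S p) @ [p - S (parent S p)] else [])"

declare address.simps [simp del]

locale addressing =
  fixes S :: "nat \<Rightarrow> nat"
  assumes mono: "mono S" and S_0: "S 0 = 0" and S_greater: "\<And>p. 1 \<le> p \<Longrightarrow> p < S p"
begin

lemma less_S_parent: "p < S (Suc (parent S p))"
proof -
  have "p < S (Suc p)" using S_greater[of "Suc p"] by simp
  then show ?thesis unfolding parent_def by (rule LeastI)
qed

lemma S_parent_le: "S (parent S p) \<le> p"
proof (cases "parent S p")
  case (Suc k)
  then have "\<not> p < S (Suc k)"
    using not_less_Least[of k "\<lambda>k. p < S (Suc k)"] by (simp add: parent_def)
  with Suc show ?thesis by simp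
qed (simp add: S_0)

lemma parent_eqI:
  assumes "S k \<le> p" "p < S (Suc k)"
  shows "parent S p = k"
  unfolding parent_def
proof (rule Least_equality)
  fix l assume l: "p < S (Suc l)"
  show "k \<le> l"
  proof (rule ccontr)
    assume "\<not> k \<le> l"
    then have "S (Suc l) \<le> S k" by (intro monoD[OF mono]) simp
    with l assms(1) show False by simp
  qed
qed fact

lemma parent_less: "1 \<le> p \<Longrightarrow> parent S p < p"
  using S_greater[of p] S_parent_le[of p] monoD[OF mono, of p "parent S p"] by linarith

lemma parent_0: "parent S 0 = 0"
  using S_greater[of 1] by (intro parent_eqI) (simp_all add: S_0)

lemma parent_mono: "p \<le> q \<Longrightarrow> parent S p \<le> parent S q"
  using less_S_parent[of q] unfolding parent_def[of S p] by (intro Least_le) simp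

lemma address_0: "address S 0 = []"
  by (simp add: address.simps)

lemma address_pos: "1 \<le> p \<Longrightarrow> address S p = address S (parent S p) @ [p - S (parent S p)]"
  by (simp add: address.simps[of S p] parent_less)

lemma address_eq_Nil_iff: "address S p = [] \<longleftrightarrow> p = 0"
  by (cases p) (simp_all add: address_0 address_pos)

lemma butlast_address: "butlast (address S p) = address S (parent S p)"
  by (cases p) (simp_all add: address_0 address_pos parent_0)

text \<open>As \<open>parent S\<close> is monotone, either the parents agree and the last digits
  decide, or the parents are in order and so, by induction, are their addresses.\<close>

lemma address_less:
  assumes r: "irrefl r" and digits: "\<And>p q. p < q \<Longrightarrow> parent S p = parent S q \<Longrightarrow>
      (p - S (parent S p), q - S (parent S q)) \<in> r"
  shows "p < q \<Longrightarrow> (address S p, address S q) \<in> lenlex r"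
proof (induction q arbitrary: p rule: less_induct)
  case (less q)
  show ?case
  proof (cases "p = 0")
    case True
    then show ?thesis using less.prems by (simp add: address_0 address_eq_Nil_iff)
  next
    case False
    then have eq: "address S p = address S (parent S p) @ [p - S (parent S p)]"
      "address S q = address S (parent S q) @ [q - S (parent S q)]"
      using less.prems by (simp_all add: address_pos)
    show ?thesis
    proof (cases "parent S p = parent S q")
      case True
      then show ?thesis
        using digits[OF less.prems True] r by (simp add: eq lenlex_append2 Cons_lenlex_iff)
    next
      case False
      then have "parent S p < parent S q" "parent S q < q"
        using parent_mono[of p q] less.prems parent_less[of q] by auto
      then show ?thesis
        unfolding eq using less.IH by (intro lenlex_append1) auto
    qed
  qed
qed

end

text \<open>Positions are represented by their addresses. The automaton for \<open>L\<close> follows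
  the letters of \<open>Y\<close> on the diagonal; the DFAO does the same with a separate digit in
  each direction.\<close>

lemma automatic_of_blocks:
  fixes x :: "('d::finite \<Rightarrow> nat) \<Rightarrow> 'g" and Y :: "('d \<Rightarrow> nat) \<Rightarrow> nat"
    and \<mu> :: "nat \<Rightarrow> ('d, nat) picture"
  assumes "mono S" "S 0 = 0" "\<And>p. 1 \<le> p \<Longrightarrow> p < S p"
    and fin: "finite (range Y)"
    and shape: "\<And>n i. shape (\<mu> (Y n)) i = enat (S (Suc (n i)) - S (n i))"
    and letter: "\<And>n r. (\<And>i. r i < S (Suc (n i)) - S (n i)) \<Longrightarrow>
      letter (\<mu> (Y n)) r = Y (\<lambda>i. S (n i) + r i)"
    and x: "\<And>n. x n = \<nu> (Y n)" and \<Gamma>: "range x \<subseteq> \<Gamma>"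
  shows "\<exists>(L :: nat list set) \<Sigma> r.
    abstract_numeration_system L \<Sigma> r \<and> [] \<in> L \<and> automatic L \<Sigma> r \<Gamma> x"
proof -
  interpret addressing S
    using assms(1-3) by unfold_locales
  define w where "w k = S (Suc k) - S k" for k
  have S_mono: "S k \<le> S (Suc k)" for k
    using monoD[OF mono] by simp
  \<comment> \<open>The width of block \<open>k\<close> can be read off the diagonal letter at
    \<open>k\<close>, so there are only finitely many widths.\<close>
  have "range w \<subseteq> (\<lambda>b. the_enat (shape (\<mu> b) i)) ` range Y" for i
  proof -
    have "w k = the_enat (shape (\<mu> (Y (\<lambda>_. k))) i)" for k
      by (simp add: shape w_def)
    then show ?thesis by blast
  qed
  then have "finite (range w)"
    using fin by (meson finite_imageI finite_subset)
  then obtain K where K: "\<And>k. w k < K"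
    using finite_nat_set_iff_bounded by (metis rangeI)
  define \<Sigma> where "\<Sigma> = {..<K}"
  define r where "r = {(i, j). i < j \<and> j < K}"
  define L where "L = range (address S)"
  have r: "Relation.trans r" "irrefl r" "total_on \<Sigma> r" "r \<subseteq> \<Sigma> \<times> \<Sigma>"
    by (auto simp: r_def irrefl_def total_on_def \<Sigma>_def intro!: transI)
  have digit: "p - S (parent S p) < w (parent S p)" for p
    using less_S_parent[of p] S_parent_le[of p] by (simp add: w_def)
  have less: "(address S p, address S q) \<in> lenlex r" if "p < q" for p q
  proof (rule address_less[OF r(2) _ that])
    fix p q assume "p < q" "parent S p = parent S q"
    moreover from this have "p - S (parent S p) < q - S (parent S q)"
      using S_parent_le[of p] by simp
    moreover have "q - S (parent S q) < K"
      using digit K less_trans by blast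
    ultimately show "(p - S (parent S p), q - S (parent S q)) \<in> r"
      by (simp add: r_def)
  qed
  have rep: "rep L r n = address S n" for n
    using less by (intro rep_eqI r) (simp_all add: L_def)
  have address_lists: "address S p \<in> lists \<Sigma>" for p
  proof (induction p rule: less_induct)
    case (less p)
    have "p - S (parent S p) < K"
      using digit K less_trans by blast
    then show ?case
      using less parent_less[of p] by (cases "p = 0") (auto simp: address_0 address_pos \<Sigma>_def)
  qed

  \<comment> \<open>\<open>None\<close> is a sink, entered by an offset outside the block of the
    current letter.\<close>
  define step :: "nat option \<Rightarrow> ('d \<Rightarrow> nat) \<Rightarrow> nat option" where
    "step q c = (case q of None \<Rightarrow> None
       | Some b \<Rightarrow> if c \<in> box (shape (\<mu> b)) then Some (letter (\<mu> b) c) else None)" for q c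
  have step_Y: "step (Some (Y n)) c =
      (if \<forall>i. c i < w (n i) then Some (Y (\<lambda>i. S (n i) + c i)) else None)" for n c
    by (auto simp: step_def box_def shape letter w_def)
  define Q where "Q = insert None (Some ` range Y)"
  have step_Q: "step q c \<in> Q" if "q \<in> Q" for q c
    by (cases "q = None") (use that in \<open>auto simp: Q_def step_Y step_def[of None] split: if_splits\<close>)
  have Q: "finite Q" "None \<in> Q" "Some (Y n) \<in> Q" for n
    using fin by (simp_all add: Q_def)

  \<comment> \<open>The outer \<^term>\<open>None\<close> is the initial state, which rejects a leading zero.\<close>
  define \<delta> :: "nat option option \<Rightarrow> nat \<Rightarrow> nat option option" where
    "\<delta> q c = (case q of None \<Rightarrow> if c = 0 then Some None else Some (step (Some (Y (\<lambda>_. 0))) (\<lambda>_. c))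
       | Some q \<Rightarrow> Some (step q (\<lambda>_. c)))" for q c
  define node where "node p = (if p = 0 then None else Some (Some (Y (\<lambda>_. p))))" for p
  \<comment> \<open>The digit 0 at position 0 would lead back to position 0, whose address is empty,
    hence its exclusion. For \<open>p\<close> at least 1, \<open>S_greater\<close> ensures that the
    child is not 0.\<close>
  have \<delta>_node: "\<delta> (node p) c = (if c < w p \<and> (p = 0 \<longrightarrow> c \<noteq> 0) then node (S p + c) else Some None)" for p c
    using S_greater[of p] by (auto simp: \<delta>_def node_def step_Y S_0)
  have run_address: "foldl \<delta> None (address S p) = node p" for p
  proof (induction p rule: less_induct)
    case (less p)
    show ?case
    proof (cases "p = 0")
      case False
      then show ?thesis
        using less parent_less[of p] S_parent_le[of p] digit[of p]
        by (auto simp: address_pos \<delta>_node S_0)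
    qed (simp add: address_0 node_def)
  qed
  \<comment> \<open>Since \<open>Some None\<close> is a sink, removing the last digit keeps the run
    outside it, and by induction the shorter word is an address.\<close>
  have run_L: "u \<in> L" if "foldl \<delta> None u \<noteq> Some None" for u
    using that
  proof (induction u rule: rev_induct)
    case Nil
    then show ?case using address_0 unfolding L_def by (metis rangeI)
  next
    case (snoc c v)
    have "\<delta> (Some None) c = Some None" by (simp add: \<delta>_def step_def)
    with snoc obtain k where k: "v = address S k" unfolding L_def by force
    with snoc.prems have c: "c < w k" "k = 0 \<longrightarrow> c \<noteq> 0"
      by (auto simp: run_address \<delta>_node split: if_splits)
    have "parent S (S k + c) = k"
      using c S_mono[of k] by (intro parent_eqI) (simp_all add: w_def)
    moreover have "1 \<le> S k + c"
      using c S_greater[of k] by (cases "k = 0") auto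
    ultimately have "address S (S k + c) = v @ [c]"
      by (simp add: address_pos k)
    then show ?case unfolding L_def by (metis rangeI)
  qed
  have "regular \<Sigma> L"
  proof (rule regularI)
    show "finite (insert None (Some ` Q))" "None \<in> insert None (Some ` Q)"
      "insert None (Some ` Q) - {Some None} \<subseteq> insert None (Some ` Q)"
      using Q by auto
    show "\<delta> q c \<in> insert None (Some ` Q)" if "q \<in> insert None (Some ` Q)" for q c
      using that step_Q Q by (auto simp: \<delta>_def)
    have "address S p \<in> lists \<Sigma> \<and>
        foldl \<delta> None (address S p) \<in> insert None (Some ` Q) - {Some None}" for p
      by (simp add: run_address address_lists node_def Q)
    then have "u \<in> L \<Longrightarrow> u \<in> lists \<Sigma> \<and> foldl \<delta> None u \<in> insert None (Some ` Q) - {Some None}" for u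
      unfolding L_def by (elim rangeE) (simp only: simp_thms)
    then show "L = {u \<in> lists \<Sigma>. foldl \<delta> None u \<in> insert None (Some ` Q) - {Some None}}"
      using run_L by (intro equalityI subsetI CollectI) (simp_all only: mem_Collect_eq Diff_iff singleton_iff simp_thms)
  qed
  moreover have "infinite L"
  proof -
    have "(v, v) \<notin> lenlex r" for v
      using r(2) by (intro lenlex_irreflexive) (auto simp: irrefl_def)
    then have "inj (address S)"
      using less by (metis injI linorder_neqE_nat)
    then show ?thesis unfolding L_def by (simp add: range_inj_infinite)
  qed
  ultimately have "abstract_numeration_system L \<Sigma> r"
    using r address_lists
    by (auto simp: abstract_numeration_system_def strict_linear_order_on_def \<Sigma>_def L_def)
  moreover have "[] \<in> L"
    unfolding L_def by (metis address_0 rangeI)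
  moreover have "automatic L \<Sigma> r \<Gamma> x"
  proof (rule automaticI)
    \<comment> \<open>Padding acts as the digit 0: a coordinate still at position 0 stays there
      because \<open>S 0 = 0\<close>.\<close>
    define digit_of :: "nat option \<Rightarrow> nat" where "digit_of = case_option 0 id"
    define \<tau> where "\<tau> q = (case q of None \<Rightarrow> x (\<lambda>_. 0) | Some b \<Rightarrow> \<nu> b)" for q
    let ?\<delta> = "\<lambda>q c. step q (\<lambda>i. digit_of (c i))"
    show "finite Q" "Some (Y (\<lambda>_. 0)) \<in> Q" by (fact Q)+
    show "?\<delta> q c \<in> Q" if "q \<in> Q" for q c using that by (rule step_Q)
    show "\<tau> q \<in> \<Gamma>" if "q \<in> Q" for q
      using that \<Gamma> x by (auto simp: Q_def \<tau>_def)
    \<comment> \<open>Removing the last column passes to the parent in every coordinate; an empty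
      address belongs to 0, which is its own parent.\<close>
    have run: "foldl ?\<delta> (Some (Y (\<lambda>_. 0))) (columns m (\<lambda>i. address S (n i))) = Some (Y n)"
      if "\<And>i. length (address S (n i)) \<le> m" for m n
      using that
    proof (induction m arbitrary: n)
      case 0
      then have "n = (\<lambda>_. 0)" by (simp add: address_eq_Nil_iff fun_eq_iff)
      then show ?case by simp
    next
      case (Suc m)
      have "length (address S (parent S (n i))) \<le> m" for i
        using Suc.prems[of i] by (simp add: butlast_address[symmetric])
      moreover have "digit_of (last_letter (address S (n i))) = n i - S (parent S (n i))" for i
        by (cases "n i") (simp_all add: digit_of_def last_letter_def address_0 address_pos)
      ultimately show ?case
        using Suc.IH[of "\<lambda>i. parent S (n i)"]
        by (simp add: butlast_address step_Y digit S_parent_le)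
    qed
    show "\<tau> (foldl ?\<delta> (Some (Y (\<lambda>_. 0))) (pad (\<lambda>i. rep L r (n i)))) = x n" for n
      by (simp add: rep pad_conv_columns run x \<tau>_def)
  qed
  ultimately show ?thesis by blast
qed

subsection \<open>The block structure of a shape-symmetric word\<close>

lemma block_start_prefix:
  fixes \<mu> :: "'a \<Rightarrow> ('d, 'b) picture"
  assumes xy: "picture_prefix x y" and x: "x \<in> pictures \<Xi>" and m: "enat m \<le> shape x i"
  shows "block_start \<mu> x i m = block_start \<mu> y i m"
  unfolding block_start_def
proof (rule sum.cong)
  fix k assume "k \<in> {..<m}"
  then have "enat k < enat m" by simp
  with m have k: "enat k < shape x i" by (metis order_less_le_trans)
  then have "shape x j > 0" for j
    using x unfolding pictures_def
    by (metis (mono_tags, lifting) mem_Collect_eq not_less_zero)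
  then have "(\<lambda>_. 0)(i := k) \<in> box (shape x)"
    using k by (auto simp: box_def zero_enat_def[symmetric])
  then show "block_width \<mu> x i k = block_width \<mu> y i k"
    using xy by (simp add: block_width_def picture_prefix_def)
qed simp

text \<open>Symmetry makes the block boundaries equal in all directions, so one function
  \<open>S\<close> suffices. Letters may have empty images, so \<open>S\<close> is only weakly
  monotone.\<close>

lemma shape_symmetric_blocks:
  fixes \<mu> :: "'a \<Rightarrow> ('d::finite, 'a) picture"
  assumes \<mu>: "multidim_morphism \<Xi> \<mu>" and a: "a \<in> \<Xi>" and "prolongable \<mu> a"
    and y: "y = morphism_limit \<mu> a" and inf: "infinite_word y" and sym: "shape_symmetric \<mu> y"
  obtains S where "mono S" "S 0 = 0" "\<And>p. 1 \<le> p \<Longrightarrow> p < S p" "range (letter y) \<subseteq> \<Xi>"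
    "\<And>n i. shape (\<mu> (letter y n)) i = enat (S (Suc (n i)) - S (n i))"
    "\<And>n r. (\<And>i. r i < S (Suc (n i)) - S (n i)) \<Longrightarrow>
      letter (\<mu> (letter y n)) r = letter y (\<lambda>i. S (n i) + r i)"
proof -
  define z where "z m = morphism_power \<mu> m a" for m
  note prefix_y = morphism_power_prefix_limit[OF assms(1-3), folded y z_def]
  have z_bounded: "z m \<in> bounded_pictures \<Xi>" for m
    unfolding z_def by (rule morphism_power_in_bounded_pictures[OF \<mu> a])
  then have z: "z m \<in> pictures \<Xi>" for m by (auto simp: bounded_pictures_def)
  have z_wd: "image_well_defined \<mu> (z m)" for m
    using \<mu> a unfolding multidim_morphism_def z_def
    by (metis diff_Suc_1 le_add1 plus_1_eq_Suc)
  have chain: "shape (z l) i \<le> shape (z m) i" if "l \<le> m" for l m i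
    using that
  proof (rule lift_Suc_mono_le[rotated])
    show "shape (z k) i \<le> shape (z (Suc k)) i" for k
      using morphism_power_prefix[OF assms(1-3), of k] by (simp add: picture_prefix_def z_def)
  qed
  have y_box: "n \<in> box (shape y)" for n
    using inf by (simp add: box_def infinite_word_def)
  \<comment> \<open>Each direction supplies its own iterate; there are finitely many directions, and
    shapes never shrink along the iteration.\<close>
  have large: "\<exists>m. \<forall>k\<ge>m. n \<in> box (shape (z k))" for n
  proof -
    have "\<exists>m. enat (n i) < shape (z m) i" for i
    proof -
      have "(SUP m. shape (z m) i) = \<infinity>"
        using inf by (simp add: y infinite_word_def morphism_limit_def Let_def z_def)
      then have "enat (n i) < (SUP m. shape (z m) i)" by simp
      then show ?thesis by (simp add: less_SUP_iff)
    qed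
    then obtain m where m: "enat (n i) < shape (z (m i)) i" for i by metis
    have "enat (n i) < shape (z k) i" if "Max (range m) \<le> k" for k i
    proof -
      have "m i \<le> k" using that by (simp add: Max_le_iff)
      from m[of i] chain[OF this, of i] show ?thesis by (rule less_le_trans)
    qed
    then show ?thesis unfolding box_def by blast
  qed
  have y_z: "letter y n = letter (z m) n" if "n \<in> box (shape (z m))" for n m
    using prefix_y that by (simp add: picture_prefix_def)
  have y_in: "letter y n \<in> \<Xi>" for n
  proof -
    obtain m where "n \<in> box (shape (z m))" using large by blast
    then show ?thesis using z[of m] by (auto simp: y_z pictures_def)
  qed
  then have bdd: "\<mu> (letter y n) \<in> bounded_pictures \<Xi>" for n
    using \<mu> by (auto simp: multidim_morphism_def)
  have finite: "shape (\<mu> (letter y n)) i \<noteq> \<infinity>" for n i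
    using bdd[of n] unfolding bounded_pictures_def by blast
  have wd: "image_well_defined \<mu> y"
    unfolding image_well_defined_def
  proof (intro allI ballI impI)
    fix i and m n :: "'d \<Rightarrow> nat" assume mn: "m i = n i"
    obtain k l where "\<forall>h\<ge>k. m \<in> box (shape (z h))" "\<forall>h\<ge>l. n \<in> box (shape (z h))"
      using large[of m] large[of n] by blast
    then have "m \<in> box (shape (z (max k l)))" "n \<in> box (shape (z (max k l)))" by auto
    then show "shape (\<mu> (letter y m)) i = shape (\<mu> (letter y n)) i"
      using z_wd[of "max k l", unfolded image_well_defined_def, rule_format, of m n i] mn
      by (simp only: y_z)
  qed
  \<comment> \<open>The limit is a fixed point: \<open>z (Suc m)\<close> is a prefix of
    \<open>y\<close> and, as the image of a prefix of \<open>y\<close>, also of the image of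
    \<open>y\<close>.\<close>
  have image: "letter (apply_morphism \<mu> y) n = letter y n" for n
  proof -
    obtain m where m: "\<forall>k\<ge>m. n \<in> box (shape (z k))" using large by blast
    have "picture_prefix (z (Suc m)) (apply_morphism \<mu> y)"
      using apply_morphism_prefix[OF prefix_y[of m] z[of m], of \<mu>] by (simp add: z_def)
    then have "letter (z (Suc m)) n = letter (apply_morphism \<mu> y) n"
      using m by (simp add: picture_prefix_def)
    then show ?thesis
      using m y_z[of n "Suc m"] by simp
  qed
  \<comment> \<open>Shape-symmetry is applied to the transposition of \<open>i\<close> and
    \<open>j\<close> at a position on the \<open>j\<close>th axis.\<close>
  have width_swap: "block_width \<mu> y i k = block_width \<mu> y j k" for i j k
  proof -
    define f where "f = id(i := j, j := i)"
    define n :: "'d \<Rightarrow> nat" where "n = (\<lambda>_. 0)(j := k)"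
    have "bij f" by (rule involuntory_imp_bij) (simp add: f_def)
    moreover have "(\<lambda>l. n (f l)) = (\<lambda>_. 0)(i := k)"
      by (auto simp: n_def f_def fun_eq_iff)
    ultimately have "shape (\<mu> (letter y ((\<lambda>_. 0)(i := k)))) i = shape (\<mu> (letter y n)) (f i)"
      using sym unfolding shape_symmetric_def by metis
    then show ?thesis by (simp add: block_width_def n_def f_def)
  qed
  define i\<^sub>0 :: 'd where "i\<^sub>0 = undefined"
  define S where "S = block_start \<mu> y i\<^sub>0"
  have S: "block_start \<mu> y i = S" for i
    unfolding S_def by (intro ext) (simp add: block_start_def width_swap[where i = i and j = i\<^sub>0])
  have mono: "mono S"
    by (auto simp: mono_def S_def block_start_def intro!: sum_mono2)
  have shape: "shape (\<mu> (letter y n)) i = enat (S (Suc (n i)) - S (n i))" for n i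
  proof -
    have "shape (\<mu> (letter y n)) i = shape (\<mu> (letter y ((\<lambda>_. 0)(i := n i)))) i"
      using y_box by (intro wd[unfolded image_well_defined_def, rule_format]) simp_all
    also have "\<dots> = enat (block_width \<mu> y i (n i))"
      unfolding block_width_def by (metis finite the_enat.simps not_infinity_eq)
    also have "block_width \<mu> y i (n i) = S (Suc (n i)) - S (n i)"
      unfolding S[of i, symmetric] by (simp add: block_start_def)
    finally show ?thesis .
  qed
  have letter: "letter (\<mu> (letter y n)) r = letter y (\<lambda>i. S (n i) + r i)"
    if "\<And>i. r i < S (Suc (n i)) - S (n i)" for n r
  proof -
    have "letter (apply_morphism \<mu> y) (\<lambda>i. block_start \<mu> y i (n i) + r i) = letter (\<mu> (letter y n)) r"
      using that by (intro apply_morphism_block(2)[OF wd y_box]) (simp_all add: box_def shape)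
    then show ?thesis by (simp add: image S)
  qed
  \<comment> \<open>If \<open>S p \<le> p\<close>, monotonicity keeps every iterate on
    \<open>a\<close> within width \<open>p\<close> in direction \<open>i\<^sub>0\<close>, so the
    limit could not be infinite.\<close>
  have "p < S p" if p: "1 \<le> p" for p
  proof (rule ccontr)
    assume "\<not> p < S p"
    then have Sp: "S p \<le> p" by simp
    have "shape (z m) i\<^sub>0 \<le> enat p" for m
    proof (induction m)
      case 0
      then show ?case using p by (simp add: z_def letter_picture_def one_enat_def)
    next
      case (Suc m)
      then obtain s where s: "shape (z m) i\<^sub>0 = enat s" "s \<le> p"
        by (cases "shape (z m) i\<^sub>0") auto
      have "shape (z (Suc m)) i\<^sub>0 = enat (S s)"
        using shape_apply_morphism_finite[OF s(1), of \<mu>] block_start_prefix[OF prefix_y z, of s m i\<^sub>0 \<mu>]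
        by (simp add: s S) (simp add: z_def)
      also have "\<dots> \<le> enat p"
        using monoD[OF mono s(2)] Sp by simp
      finally show ?case .
    qed
    moreover obtain m where "(\<lambda>_. p) \<in> box (shape (z m))" using large by blast
    ultimately show False
      by (auto simp: box_def) (meson leD)
  qed
  with mono y_in shape letter show ?thesis
    by (intro that[of S]) (auto simp: S_def block_start_def)
qed

subsection \<open>The block structure of a regular language\<close>

locale numeration =
  fixes L :: "'a list set" and \<Sigma> :: "'a set" and r :: "'a rel"
    and Q :: "'q set" and q\<^sub>0 :: 'q and \<delta> :: "'q \<Rightarrow> 'a \<Rightarrow> 'q" and F :: "'q set"
  assumes finite_\<Sigma>: "finite \<Sigma>" and trans: "Relation.trans r" and irrefl: "irrefl r"
    and total: "total_on \<Sigma> r"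
    and finite_Q: "finite Q" and q\<^sub>0: "q\<^sub>0 \<in> Q"
    and \<delta>: "\<And>q c. q \<in> Q \<Longrightarrow> c \<in> \<Sigma> \<Longrightarrow> \<delta> q c \<in> Q"
    and L: "L = {w \<in> lists \<Sigma>. foldl \<delta> q\<^sub>0 w \<in> F}"
    and infinite_L: "infinite L" and Nil_in_L: "[] \<in> L"
begin

definition run :: "'a list \<Rightarrow> 'q" where
  "run w = foldl \<delta> q\<^sub>0 w"

lemma run_in_Q: "w \<in> lists \<Sigma> \<Longrightarrow> run w \<in> Q"
  unfolding run_def by (induction w rule: rev_induct) (auto simp: q\<^sub>0 \<delta>)

definition pos :: "'a list \<Rightarrow> nat" where
  "pos w = card {v \<in> L. (v, w) \<in> lenlex r}"

lemma trans_lenlex: "Relation.trans (lenlex r)"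
  using trans by (rule lenlex_transI)

lemma irrefl_lenlex: "irrefl (lenlex r)"
  using irrefl lenlex_irreflexive[of r] by (auto simp: irrefl_def)

lemma finite_predecessors: "finite {v \<in> lists \<Sigma>. (v, w) \<in> lenlex r}"
proof (rule finite_subset)
  show "finite {v. set v \<subseteq> \<Sigma> \<and> length v \<le> length w}"
    by (rule finite_lists_length_le[OF finite_\<Sigma>])
qed (auto dest: lenlex_length)

lemma finite_predecessors_L: "finite {v \<in> L. (v, w) \<in> lenlex r}"
  by (rule finite_subset[OF _ finite_predecessors[of w]]) (auto simp: L)

lemma total_L: "total_on L (lenlex r)"
  using total_on_lenlex[OF total] by (auto simp: L total_on_def)

lemma pos_less: "v \<in> L \<Longrightarrow> (v, w) \<in> lenlex r \<Longrightarrow> pos v < pos w"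
  unfolding pos_def by (rule rank_strict_mono[OF trans_lenlex irrefl_lenlex finite_predecessors_L])

text \<open>Being injective on an infinite set, \<open>pos\<close> is unbounded; a word of rank at
  least \<open>n\<close> together with its finitely many predecessors realises all ranks up to its
  own.\<close>

lemma pos_bij: "bij_betw pos L UNIV"
proof -
  have inj: "inj_on pos L"
    unfolding pos_def
    by (intro rank_inj_on trans_lenlex irrefl_lenlex total_L finite_predecessors_L)
  have "n \<in> pos ` L" for n
  proof -
    have "\<not> pos ` L \<subseteq> {..<n}"
      using inj infinite_L finite_imageD finite_subset by blast
    then obtain w where w: "w \<in> L" "n \<le> pos w"
      by (meson image_subsetI lessThan_iff linorder_not_le)
    define X where "X = insert w {v \<in> L. (v, w) \<in> lenlex r}"
    have "finite X" "X \<subseteq> L" using w finite_predecessors_L by (auto simp: X_def)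
    have pos_X: "card {y \<in> X. (y, x) \<in> lenlex r} = pos x" if "x \<in> X" for x
    proof -
      have "{y \<in> X. (y, x) \<in> lenlex r} = {y \<in> L. (y, x) \<in> lenlex r}"
        using that \<open>X \<subseteq> L\<close> transD[OF trans_lenlex] by (auto simp: X_def)
      then show ?thesis by (simp add: pos_def)
    qed
    have "total_on X (lenlex r)" using total_L \<open>X \<subseteq> L\<close> by (auto simp: total_on_def)
    then have "bij_betw pos X {..<card X}"
      using rank_bij_betw[OF trans_lenlex irrefl_lenlex _ \<open>finite X\<close>] pos_X
      by (simp cong: bij_betw_cong)
    moreover have "card X = Suc (pos w)"
      using finite_predecessors_L irrefl_lenlex by (simp add: X_def pos_def irrefl_def)
    ultimately have "n \<in> pos ` X" using w by (auto simp: bij_betw_def)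
    then show ?thesis using \<open>X \<subseteq> L\<close> by blast
  qed
  with inj show ?thesis by (auto simp: bij_betw_def)
qed

abbreviation rep_L :: "nat \<Rightarrow> 'a list" where "rep_L \<equiv> rep L r"

lemma rep_pos: "w \<in> L \<Longrightarrow> rep_L (pos w) = w"
  unfolding rep_def pos_def[symmetric]
  using pos_bij by (intro the_equality) (auto simp: bij_betw_def inj_on_def)

lemma rep_in_L: "rep_L n \<in> L" and pos_rep: "pos (rep_L n) = n"
proof -
  obtain w where "w \<in> L" "n = pos w"
    using pos_bij by (metis UNIV_I bij_betw_def imageE)
  then show "rep_L n \<in> L" "pos (rep_L n) = n" by (simp_all add: rep_pos)
qed

lemma rep_in_lists: "rep_L n \<in> lists \<Sigma>"
  using rep_in_L by (auto simp: L)

lemma rep_inj: "rep_L m = rep_L n \<Longrightarrow> m = n"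
  by (metis pos_rep)

lemma rep_less_iff: "(rep_L m, rep_L n) \<in> lenlex r \<longleftrightarrow> m < n"
proof -
  have *: "m < n" if "(rep_L m, rep_L n) \<in> lenlex r" for m n
    using pos_less[OF rep_in_L that] by (simp add: pos_rep)
  have "(rep_L m, rep_L n) \<in> lenlex r \<or> (rep_L n, rep_L m) \<in> lenlex r" if "m < n"
    using total_L rep_in_L rep_inj[of m n] that by (auto simp: total_on_def)
  with * show ?thesis by (metis less_asym)
qed

lemma length_rep_mono: "m \<le> n \<Longrightarrow> length (rep_L m) \<le> length (rep_L n)"
  using rep_less_iff[of m n] lenlex_length by (cases "m = n") auto

lemma less_of_length_rep_less: "length (rep_L m) < length (rep_L n) \<Longrightarrow> m < n"
  using length_rep_mono[of n m] by linarith

lemma rep_0: "rep_L 0 = []"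
proof -
  have "pos [] = 0" by (simp add: pos_def)
  then show ?thesis using rep_pos[OF Nil_in_L] by simp
qed

text \<open>Also the number of words of \<open>L\<close> shorter than \<open>k\<close>, since these
  occupy exactly the positions below it.\<close>

definition first :: "nat \<Rightarrow> nat" where
  "first k = (LEAST n. k \<le> length (rep_L n))"

lemma length_rep_ge_iff: "k \<le> length (rep_L n) \<longleftrightarrow> first k \<le> n"
proof
  have "\<exists>n. k \<le> length (rep_L n)"
  proof (rule ccontr)
    assume "\<not> ?thesis"
    then have "L \<subseteq> {w. set w \<subseteq> \<Sigma> \<and> length w \<le> k}"
      using rep_pos by (metis (no_types, lifting) L in_listsD linorder_linear mem_Collect_eq subsetI)
    then show False
      using infinite_L finite_lists_length_le[OF finite_\<Sigma>] finite_subset by blast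
  qed
  then have "k \<le> length (rep_L (first k))"
    unfolding first_def by (rule LeastI_ex)
  also assume "first k \<le> n"
  then have "length (rep_L (first k)) \<le> length (rep_L n)" by (rule length_rep_mono)
  finally show "k \<le> length (rep_L n)" .
qed (simp add: first_def Least_le)

section \<open>Words of the language with a given prefix\<close>

definition acc :: "'q \<Rightarrow> nat \<Rightarrow> 'a list set" where
  "acc q k = {z \<in> lists \<Sigma>. length z = k \<and> foldl \<delta> q z \<in> F}"

definition count :: "'q \<Rightarrow> nat \<Rightarrow> nat" where
  "count q k = card (acc q k)"

definition idx :: "'q \<Rightarrow> nat \<Rightarrow> 'a list \<Rightarrow> nat" where
  "idx q k z = card {z' \<in> acc q k. (z', z) \<in> lenlex r}"

definition enum :: "'q \<Rightarrow> nat \<Rightarrow> nat \<Rightarrow> 'a list" where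
  "enum q k = inv_into (acc q k) (idx q k)"

lemma finite_acc: "finite (acc q k)"
  by (rule finite_subset[OF _ finite_lists_length_eq[OF finite_\<Sigma>, of k]]) (auto simp: acc_def)

lemma idx_bij: "bij_betw (idx q k) (acc q k) {..<count q k}"
proof -
  have "total_on (acc q k) (lenlex r)"
    using total_on_lenlex[OF total] by (auto simp: acc_def total_on_def)
  then show ?thesis
    unfolding idx_def count_def
    by (intro rank_bij_betw trans_lenlex irrefl_lenlex finite_acc)
qed

lemma enum_in_acc: "i < count q k \<Longrightarrow> enum q k i \<in> acc q k"
  and idx_enum: "i < count q k \<Longrightarrow> idx q k (enum q k i) = i"
  using idx_bij[of q k] unfolding enum_def bij_betw_def
  by (auto intro: inv_into_into f_inv_into_f)

lemma idx_less: "z \<in> acc q k \<Longrightarrow> idx q k z < count q k"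
  using idx_bij[of q k] unfolding bij_betw_def by auto

text \<open>The position in \<open>L\<close> of the first word of length \<open>|v| + k\<close> with prefix \<open>v\<close>, if there is one.\<close>

definition base :: "'a list \<Rightarrow> nat \<Rightarrow> nat" where
  "base v k = card {x \<in> L. length x < length v + k \<or>
      length x = length v + k \<and> (take (length v) x, v) \<in> lenlex r}"

lemma append_in_L: "v \<in> lists \<Sigma> \<Longrightarrow> z \<in> acc (run v) k \<Longrightarrow> v @ z \<in> L"
  by (auto simp: L acc_def run_def)

text \<open>The words before \<open>v @ z\<close> are those counted by \<open>base\<close>, whatever
  \<open>z\<close> is, and those with prefix \<open>v\<close> and a smaller suffix. Hence the words
  that extend \<open>v\<close> by \<open>k\<close> letters fill consecutive positions.\<close>

lemma pos_append:
  assumes v: "v \<in> lists \<Sigma>" and z: "z \<in> acc (run v) k"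
  shows "pos (v @ z) = base v k + idx (run v) k z"
proof -
  let ?A = "{x \<in> L. length x < length v + k \<or>
      length x = length v + k \<and> (take (length v) x, v) \<in> lenlex r}"
  let ?B = "(@) v ` {z' \<in> acc (run v) k. (z', z) \<in> lenlex r}"
  have len: "length z = k" using z by (simp add: acc_def)
  have split: "(x, v @ z) \<in> lenlex r \<longleftrightarrow> (take (length v) x, v) \<in> lenlex r \<or>
      take (length v) x = v \<and> (drop (length v) x, z) \<in> lenlex r"
    if "length x = length v + k" for x
    using that len lenlex_append_iff[OF irrefl, of "take (length v) x" v "drop (length v) x" z]
    by simp
  have longer: "(x, v @ z) \<in> lenlex r \<longleftrightarrow> length x < length v + k"
    if "length x \<noteq> length v + k" for x
    using that len by (auto simp: lenlex_conv)
  have "{x \<in> L. (x, v @ z) \<in> lenlex r} = ?A \<union> ?B"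
  proof (intro equalityI subsetI)
    fix x assume "x \<in> {x \<in> L. (x, v @ z) \<in> lenlex r}"
    then have x: "x \<in> L" "(x, v @ z) \<in> lenlex r" by auto
    show "x \<in> ?A \<union> ?B"
    proof (cases "x \<in> ?A")
      case False
      then have lx: "length x = length v + k" and *: "take (length v) x = v"
          "(drop (length v) x, z) \<in> lenlex r"
        using x split[of x] longer[of x] by blast+
      have xv: "x = v @ drop (length v) x" using *(1) by (metis append_take_drop_id)
      have "foldl \<delta> q\<^sub>0 (v @ drop (length v) x) \<in> F"
        using x(1) xv by (simp add: L)
      moreover have "drop (length v) x \<in> lists \<Sigma>"
        using x(1) by (auto simp: L dest: in_set_dropD)
      ultimately have "drop (length v) x \<in> acc (run v) k"
        using lx by (simp add: acc_def run_def)
      then show ?thesis using * xv by blast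
    qed blast
  next
    fix x assume "x \<in> ?A \<union> ?B"
    then consider "x \<in> ?A" | z' where "z' \<in> acc (run v) k" "(z', z) \<in> lenlex r" "x = v @ z'"
      by blast
    then show "x \<in> {x \<in> L. (x, v @ z) \<in> lenlex r}"
    proof cases
      case 1
      then show ?thesis using split[of x] longer[of x] by auto
    next
      case 2
      then show ?thesis using append_in_L[OF v] split[of x] by (auto simp: acc_def)
    qed
  qed
  moreover have "?A \<inter> ?B = {}"
    using irrefl_lenlex by (auto simp: acc_def irrefl_def)
  moreover have "finite ?A"
    by (rule finite_subset[OF _ finite_lists_length_le[OF finite_\<Sigma>, of "length v + k"]])
      (auto simp: L)
  moreover have "finite ?B" using finite_acc by simp
  ultimately have "pos (v @ z) = card ?A + card ?B"
    by (simp add: pos_def card_Un_disjoint)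
  moreover have "card ?B = idx (run v) k z"
    unfolding idx_def by (rule card_image) (simp add: inj_on_def)
  ultimately show ?thesis by (simp add: base_def)
qed

definition node :: "'a list \<Rightarrow> nat \<Rightarrow> nat \<Rightarrow> 'a list" where
  "node v k i = v @ enum (run v) k i"

context
  fixes v k i
  assumes v: "v \<in> lists \<Sigma>" and i: "i < count (run v) k"
begin

lemma rep_base: "rep_L (base v k + i) = node v k i"
  using rep_pos[OF append_in_L[OF v enum_in_acc[OF i]]] pos_append[OF v enum_in_acc[OF i]] idx_enum[OF i]
  by (simp add: node_def)

lemma length_enum: "length (enum (run v) k i) = k"
  using enum_in_acc[OF i] by (simp add: acc_def)

lemma length_rep_base: "length (rep_L (base v k + i)) = length v + k"
  by (simp add: rep_base node_def length_enum)

lemma drop_end_rep_base: "drop_end k (rep_L (base v k + i)) = v"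
  by (simp add: rep_base node_def length_enum drop_end_append)

lemma take_end_rep_base: "take_end k (rep_L (base v k + i)) = enum (run v) k i"
  by (simp add: rep_base node_def length_enum take_end_append)

end

lemma ex_base:
  assumes "k \<le> length (rep_L n)"
  obtains v i where "v \<in> lists \<Sigma>" "i < count (run v) k" "n = base v k + i"
proof -
  define v where "v = drop_end k (rep_L n)"
  define z where "z = take_end k (rep_L n)"
  have vz: "v @ z = rep_L n" by (simp add: v_def z_def drop_end_append_take_end)
  have lists: "v \<in> lists \<Sigma>" "z \<in> lists \<Sigma>"
    using rep_in_lists[of n] unfolding vz[symmetric] by auto
  moreover have "length z = k"
    using assms by (simp add: z_def length_take_end)
  moreover have "foldl \<delta> q\<^sub>0 (v @ z) \<in> F"
    using rep_in_L[of n] unfolding vz by (simp add: L)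
  ultimately have z: "z \<in> acc (run v) k" by (simp add: acc_def run_def)
  have "n = base v k + idx (run v) k z"
    using pos_append[OF lists(1) z] by (simp add: vz pos_rep)
  then show thesis using that lists(1) idx_less[OF z] by blast
qed

text \<open>Dickson's lemma is applied along an enumeration of \<open>A\<close>, which consists of
  the positive lengths of words of \<open>L\<close>.\<close>

lemma ex_comparable_lengths:
  obtains s t where "1 \<le> s" "s < t" "0 < count q\<^sub>0 s"
    "\<And>q. q \<in> Q \<Longrightarrow> count q s \<le> count q t"
    "\<And>q. q \<in> Q \<Longrightarrow> 0 < count q t \<Longrightarrow> 0 < count q s"
proof -
  define A where "A = {k. 1 \<le> k \<and> 0 < count q\<^sub>0 k}"
  have "infinite A"
  proof
    assume "finite A"
    then obtain N where N: "\<And>k. k \<in> A \<Longrightarrow> k < N"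
      using finite_nat_set_iff_bounded by auto
    have "length w \<le> N" if "w \<in> L" for w
    proof (rule ccontr)
      assume "\<not> length w \<le> N"
      moreover have "w \<in> acc q\<^sub>0 (length w)" using that by (simp add: acc_def L)
      then have "0 < count q\<^sub>0 (length w)"
        unfolding count_def using finite_acc card_gt_0_iff by blast
      ultimately show False using N[of "length w"] by (simp add: A_def)
    qed
    then have "L \<subseteq> {w. set w \<subseteq> \<Sigma> \<and> length w \<le> N}" by (auto simp: L)
    then show False
      using infinite_L finite_lists_length_le[OF finite_\<Sigma>] finite_subset by blast
  qed
  define e where "e = enumerate A"
  have e: "strict_mono e" "e n \<in> A" for n
    using \<open>infinite A\<close> by (simp_all add: e_def strict_mono_enumerate enumerate_in_set)
  \<comment> \<open>The second component makes the set of states with \<^term>\<open>count q k = 0\<close> monotone as well.\<close>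
  define f where "f n = (\<lambda>(q, b). if b then count q (e n) else if count q (e n) = 0 then 1 else 0 :: nat)" for n
  obtain h where h: "strict_mono h" "\<And>q b. q \<in> Q \<Longrightarrow> incseq (\<lambda>n. f (h n) (q, b))"
    using dickson[of "Q \<times> (UNIV :: bool set)" f] finite_Q by auto
  have mono: "f (h 0) (q, b) \<le> f (h 1) (q, b)" if "q \<in> Q" for q b
    using incseqD[OF h(2)[OF that], of 0 1] by simp
  show thesis
  proof (rule that[of "e (h 0)" "e (h 1)"])
    show "1 \<le> e (h 0)" "0 < count q\<^sub>0 (e (h 0))" using e(2)[of "h 0"] by (simp_all add: A_def)
    show "e (h 0) < e (h 1)" using e(1) h(1) by (simp add: strict_mono_def)
    show "count q (e (h 0)) \<le> count q (e (h 1))" if "q \<in> Q" for q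
      using mono[OF that, of True] by (simp add: f_def)
    show "0 < count q (e (h 0))" if "q \<in> Q" "0 < count q (e (h 1))" for q
      using mono[OF that(1), of False] that(2) by (simp add: f_def split: if_splits)
  qed
qed

text \<open>With the same suffix length \<open>k\<close> on both sides, comparing the lengths of the
  words compares those of the prefixes; at equal length the prefixes are compared before the
  suffixes.\<close>

lemma less_imp_lex_prefix:
  assumes v: "v \<in> lists \<Sigma>" "i < count (run v) k" and v': "v' \<in> lists \<Sigma>" "i' < count (run v') k"
    and less: "base v k + i < base v' k + i'"
  shows "(v, v') \<in> lenlex r \<or> v = v' \<and> i < i'"
proof (cases "length v = length v'")
  case True
  have "(node v k i, node v' k i') \<in> lenlex r"
    using less rep_less_iff by (simp flip: rep_base[OF v] rep_base[OF v'])
  then have "(v, v') \<in> lenlex r \<or> v = v'"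
    using lenlex_append_iff[OF irrefl True] length_enum[OF v] length_enum[OF v']
    by (auto simp: node_def)
  with less show ?thesis by auto
next
  case False
  have "length (rep_L (base v k + i)) \<le> length (rep_L (base v' k + i'))"
    using less by (intro length_rep_mono) simp
  with False show ?thesis
    by (simp add: length_rep_base v v' lenlex_conv)
qed

lemma lex_prefix_imp_less:
  assumes v: "v \<in> lists \<Sigma>" "i < count (run v) k" and v': "v' \<in> lists \<Sigma>" "i' < count (run v') k"
    and less: "(v, v') \<in> lenlex r"
  shows "base v k + i < base v' k + i'"
proof -
  have "(node v k i, node v' k i') \<in> lenlex r"
    unfolding node_def
    using less by (rule lenlex_append1) (simp add: length_enum v v')
  then show ?thesis
    using rep_less_iff by (simp flip: rep_base[OF v] rep_base[OF v'])
qed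

text \<open>The data kept for one coordinate in a letter of the morphic word. A word shorter than
  \<open>k\<close> is recorded in full.\<close>

definition suffix_type :: "nat \<Rightarrow> nat \<Rightarrow> 'q \<times> 'a list" where
  "suffix_type k n = (run (drop_end k (rep_L n)), take_end k (rep_L n))"

lemma suffix_type_eq_short:
  assumes "suffix_type k m = suffix_type k n" "length (rep_L m) < k"
  shows "m = n"
proof (rule rep_inj)
  have eq: "take_end k (rep_L m) = take_end k (rep_L n)" using assms(1) by (simp add: suffix_type_def)
  then have "min k (length (rep_L m)) = min k (length (rep_L n))"
    by (metis length_take_end)
  with assms(2) have "length (rep_L n) < k" by auto
  with eq assms(2) show "rep_L m = rep_L n" by (simp add: take_end_def)
qed

text \<open>The children of a position with a long word form a translate of a set determined by the
  state and the suffix; a position with a short word is determined by its type.\<close>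

lemma ex_block_structure:
  obtains s t S where "s \<le> t" "strict_mono S" "S 0 = 0" "2 \<le> S 1"
    "\<And>n c. S n \<le> c \<Longrightarrow> c < S (Suc n) \<Longrightarrow> drop_end t (rep_L c) = drop_end s (rep_L n)"
    "\<And>m n. suffix_type s m = suffix_type s n \<Longrightarrow> S (Suc m) - S m = S (Suc n) - S n"
    "\<And>m n j. suffix_type s m = suffix_type s n \<Longrightarrow> j < S (Suc m) - S m \<Longrightarrow>
      take_end t (rep_L (S m + j)) = take_end t (rep_L (S n + j))"
proof -
  obtain s t where s: "1 \<le> s" "s < t" "0 < count q\<^sub>0 s"
    and le: "\<And>q. q \<in> Q \<Longrightarrow> count q s \<le> count q t"
    and supp: "\<And>q. q \<in> Q \<Longrightarrow> 0 < count q t \<Longrightarrow> 0 < count q s"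
    using ex_comparable_lengths by blast

  have "s \<le> length (rep_L n) \<Longrightarrow> 0 < n" for n
    using s(1) rep_0 by (cases "n = 0") auto
  then have first_pos: "0 < first s"
    using length_rep_ge_iff by (metis order_refl)
  \<comment> \<open>A word of length \<open>s\<close> exists because
    \<open>count q\<^sub>0 s\<close> is positive; its position separates the two values.\<close>
  have "first s < first t"
  proof -
    have "enum q\<^sub>0 s 0 \<in> acc (run []) s"
      using enum_in_acc[OF s(3)] by (simp add: run_def)
    then have "enum q\<^sub>0 s 0 \<in> L" "length (enum q\<^sub>0 s 0) = s"
      using append_in_L[of "[]"] by (auto simp: acc_def)
    then obtain n where "length (rep_L n) = s" by (metis rep_pos)
    then have "first s \<le> n" "\<not> first t \<le> n"
      using length_rep_ge_iff[of s n] length_rep_ge_iff[of t n] s(2) by auto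
    then show ?thesis by simp
  qed

  \<comment> \<open>Words shorter than \<open>t\<close> carry no prefix information; a shift maps them onto those shorter
    than \<open>s\<close> and makes every parent but that of \<open>0\<close> smaller than its child.\<close>
  define par where "par n = (if n < first t then n - (first t - first s)
    else let v = drop_end t (rep_L n) in base v s + min (n - base v t) (count (run v) s - 1))" for n
  have par_short: "par n = n - (first t - first s)" if "n < first t" for n
    using that by (simp add: par_def)
  have base_ge: "first k \<le> base v k + i" if "v \<in> lists \<Sigma>" "i < count (run v) k" for v k i
    using length_rep_ge_iff[of k "base v k + i"] length_rep_base[OF that] by simp
  \<comment> \<open>On the words with prefix \<open>v\<close> the parent map keeps the index and
    caps it at the last available one; as \<open>count q s \<le> count q t\<close>, every index for
    \<open>s\<close> is reached.\<close>
  have par_base: "par (base v t + i) = base v s + min i (count (run v) s - 1)"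
    if "v \<in> lists \<Sigma>" "i < count (run v) t" for v i
    using base_ge[OF that] drop_end_rep_base[OF that] by (simp add: par_def Let_def)
  \<comment> \<open>The support condition enters here: a prefix with a suffix of length
    \<open>t\<close> also has one of length \<open>s\<close>, so the capped index names a
    word.\<close>
  have min_less: "min i (count (run v) s - 1) < count (run v) s"
    if "v \<in> lists \<Sigma>" "i < count (run v) t" for v i
    using supp[OF run_in_Q[OF that(1)]] that(2) by (simp add: min_def) linarith
  have par_long: "first s \<le> par n" if n: "first t \<le> n" for n
  proof -
    obtain v i where v: "v \<in> lists \<Sigma>" "i < count (run v) t" "n = base v t + i"
      using n ex_base length_rep_ge_iff by metis
    show ?thesis using base_ge[OF v(1) min_less[OF v(1,2)]] by (simp add: v(3) par_base[OF v(1,2)])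
  qed

  \<comment> \<open>Short positions are sent to at most \<open>first s\<close>, long ones to at
    least \<open>first s\<close>. Among long ones a smaller prefix gives a smaller parent whatever
    the indices, and for one prefix the cap is monotone.\<close>
  have "par m \<le> par n" if "m < n" for m n
  proof (cases "n < first t")
    case True
    then show ?thesis using that by (simp add: par_short)
  next
    case n: False
    show ?thesis
    proof (cases "m < first t")
      case True
      then have "par m \<le> first s" using \<open>first s < first t\<close> by (simp add: par_short)
      then show ?thesis using par_long[of n] n by simp
    next
      case False
      obtain v i where v: "v \<in> lists \<Sigma>" "i < count (run v) t" and m_eq: "m = base v t + i"
        using False ex_base length_rep_ge_iff by (metis not_less)
      obtain v' i' where v': "v' \<in> lists \<Sigma>" "i' < count (run v') t" and n_eq: "n = base v' t + i'"
        using n ex_base length_rep_ge_iff by (metis not_less)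
      have "(v, v') \<in> lenlex r \<or> v = v' \<and> i < i'"
        using less_imp_lex_prefix[OF v v'] that by (simp add: m_eq n_eq)
      then show ?thesis
      proof
        assume "(v, v') \<in> lenlex r"
        then have "base v s + min i (count (run v) s - 1) < base v' s + min i' (count (run v') s - 1)"
          by (intro lex_prefix_imp_less v v' min_less)
        then show ?thesis by (simp add: m_eq n_eq par_base v v')
      qed (use v' in \<open>auto simp: m_eq n_eq par_base v\<close>)
    qed
  qed
  then have "mono par" by (metis monoI le_less order_refl)

  have "\<exists>m. par m = n" for n
  proof (cases "n < first s")
    case True
    then show ?thesis
      using \<open>first s < first t\<close> by (intro exI[of _ "n + (first t - first s)"]) (simp add: par_short)
  next
    case False
    then obtain v i where v: "v \<in> lists \<Sigma>" "i < count (run v) s" "n = base v s + i"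
      using ex_base length_rep_ge_iff by (metis not_less)
    then have "i < count (run v) t" using le[OF run_in_Q[OF v(1)]] by simp
    then show ?thesis
      using v by (intro exI[of _ "base v t + i"]) (simp add: par_base)
  qed
  then have "surj par" by (metis surjI)

  have "par n < n" if "1 \<le> n" for n
  proof (cases "n < first t")
    case True
    then show ?thesis using that \<open>first s < first t\<close> by (simp add: par_short)
  next
    case False
    then obtain v i where v: "v \<in> lists \<Sigma>" "i < count (run v) t" "n = base v t + i"
      using ex_base length_rep_ge_iff by (metis not_less)
    have "length (rep_L (par n)) < length (rep_L n)"
      using length_rep_base[OF v(1) min_less[OF v(1,2)]] length_rep_base[OF v(1,2)] s(2)
      by (simp add: par_base v)
    then show ?thesis by (rule less_of_length_rep_less)
  qed
  then obtain S where S: "strict_mono S" "S 0 = 0" "2 \<le> S 1"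
    and fibre: "\<And>m k. par m = k \<longleftrightarrow> S k \<le> m \<and> m < S (Suc k)"
    using fibres_of_mono_surj[OF \<open>mono par\<close> \<open>surj par\<close>] by blast

  have drop: "drop_end t (rep_L c) = drop_end s (rep_L (par c))" for c
  proof (cases "c < first t")
    case True
    then have "par c < first s"
      using first_pos \<open>first s < first t\<close> by (simp add: par_short)
    with True have "length (rep_L c) < t" "length (rep_L (par c)) < s"
      by (simp_all add: length_rep_ge_iff flip: not_le)
    then show ?thesis by (simp add: drop_end_def)
  next
    case False
    then obtain v i where v: "v \<in> lists \<Sigma>" "i < count (run v) t" "c = base v t + i"
      using ex_base length_rep_ge_iff by (metis not_less)
    show ?thesis
      using drop_end_rep_base[OF v(1,2)] drop_end_rep_base[OF v(1) min_less[OF v(1,2)]]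
      by (simp add: v par_base)
  qed

  \<comment> \<open>\<open>J\<close> sees the prefix only through its state, so the fibres over two
    positions of equal type are translates of one set.\<close>
  define J where "J q i = {j. j < count q t \<and> min j (count q s - 1) = i}" for q i
  have fibre_base: "{S n..<S (Suc n)} = (+) (base v t) ` J (run v) i"
    if v: "v \<in> lists \<Sigma>" "i < count (run v) s" and n: "n = base v s + i" for v i n
  proof (intro equalityI subsetI)
    fix c assume "c \<in> {S n..<S (Suc n)}"
    then have c: "par c = n" using fibre by simp
    have "first t \<le> c"
    proof (rule ccontr)
      assume "\<not> first t \<le> c"
      then have "par c < first s"
        using first_pos \<open>first s < first t\<close> by (simp add: par_short)
      with base_ge[OF v] show False by (simp add: c n)
    qed
    then obtain v' j where v': "v' \<in> lists \<Sigma>" "j < count (run v') t" and c_eq: "c = base v' t + j"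
      using ex_base length_rep_ge_iff by metis
    have "base v' s + min j (count (run v') s - 1) = base v s + i"
      using c by (simp add: c_eq par_base[OF v'] n)
    moreover from this have "v' = v"
      using drop_end_rep_base[OF v] drop_end_rep_base[OF v'(1) min_less[OF v']] by simp
    ultimately show "c \<in> (+) (base v t) ` J (run v) i"
      using v' by (auto simp: J_def c_eq)
  next
    fix c assume "c \<in> (+) (base v t) ` J (run v) i"
    then obtain j where "c = base v t + j" "j < count (run v) t" "min j (count (run v) s - 1) = i"
      by (auto simp: J_def)
    then have "par c = n" using v by (simp add: par_base n)
    then show "c \<in> {S n..<S (Suc n)}" using fibre by simp
  qed
  have take: "S (Suc m) - S m = S (Suc n) - S n \<and> (\<forall>j < S (Suc m) - S m.
      take_end t (rep_L (S m + j)) = take_end t (rep_L (S n + j)))"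
    if suffix_type: "suffix_type s m = suffix_type s n" for m n
  proof (cases "m = n")
    case False
    \<comment> \<open>A word shorter than \<open>s\<close> is determined by its type, so distinct
      positions of equal type both have long words.\<close>
    then have "s \<le> length (rep_L m)" "s \<le> length (rep_L n)"
      using suffix_type_eq_short[OF suffix_type] suffix_type_eq_short[OF suffix_type[symmetric]] by (metis not_less)+
    then obtain v i v' i' where v: "v \<in> lists \<Sigma>" "i < count (run v) s" and m_eq: "m = base v s + i"
      and v': "v' \<in> lists \<Sigma>" "i' < count (run v') s" and n_eq: "n = base v' s + i'"
      using ex_base by metis
    have "(run v, enum (run v) s i) = (run v', enum (run v') s i')"
      using suffix_type unfolding suffix_type_def m_eq n_eq
      by (simp only: drop_end_rep_base take_end_rep_base v v')
    then have q: "run v = run v'" and "i = i'"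
      using idx_enum[OF v(2)] idx_enum[OF v'(2)] by (metis prod.inject)+
    note I = fibre_base[OF v m_eq] and I' = fibre_base[OF v' n_eq, folded q \<open>i = i'\<close>]
    have "S m < S (Suc m)" using S(1) by (simp add: strict_mono_less)
    note eq = translated_intervals[OF I I' this]
    have "take_end t (rep_L (S m + j)) = take_end t (rep_L (S n + j))" if "j < S (Suc m) - S m" for j
    proof -
      have "S m + j \<in> (+) (base v t) ` J (run v) i" using that unfolding I[symmetric] by auto
      then obtain k where k: "S m + j = base v t + k" "k < count (run v) t" by (auto simp: J_def)
      with eq(2) have "S n + j = base v' t + k" by linarith
      with k show ?thesis by (simp add: take_end_rep_base v v' q)
    qed
    with eq(1) show ?thesis by blast
  qed simp
  show thesis
  proof (rule that[OF _ S])
    show "drop_end t (rep_L c) = drop_end s (rep_L n)" if "S n \<le> c" "c < S (Suc n)" for n c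
      using drop[of c] fibre[of c n] that by simp
    show "s \<le> t" using s(2) by simp
    show "S (Suc m) - S m = S (Suc n) - S n" if "suffix_type s m = suffix_type s n" for m n
      using take[OF that] by blast
    show "take_end t (rep_L (S m + j)) = take_end t (rep_L (S n + j))"
      if "suffix_type s m = suffix_type s n" "j < S (Suc m) - S m" for m n j
      using take[OF that(1)] that(2) by blast
  qed
qed

end

subsection \<open>The equivalence\<close>

lemma morphic_of_automatic:
  fixes x :: "('d::finite \<Rightarrow> nat) \<Rightarrow> 'g"
  assumes ans: "abstract_numeration_system L \<Sigma> r" and "[] \<in> L" and aut: "automatic L \<Sigma> r \<Gamma> x"
    and \<Gamma>: "range x \<subseteq> \<Gamma>"
  shows "\<exists>(\<Xi> :: nat set) (\<mu> :: nat \<Rightarrow> ('d, nat) picture) a \<nu>.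
            finite \<Xi> \<and> multidim_morphism \<Xi> \<mu> \<and> a \<in> \<Xi> \<and> prolongable \<mu> a \<and>
            infinite_word (morphism_limit \<mu> a) \<and>
            shape_symmetric \<mu> (morphism_limit \<mu> a) \<and>
            \<nu> \<in> \<Xi> \<rightarrow> \<Gamma> \<and> (\<forall>n. x n = \<nu> (letter (morphism_limit \<mu> a) n))"
proof -
  obtain Q :: "nat set" and q\<^sub>0 \<delta> F where "finite Q" "q\<^sub>0 \<in> Q" "\<forall>q\<in>Q. \<forall>c\<in>\<Sigma>. \<delta> q c \<in> Q"
    "L = {w \<in> lists \<Sigma>. foldl \<delta> q\<^sub>0 w \<in> F}"
    using ans unfolding abstract_numeration_system_def regular_def by blast
  then interpret numeration L \<Sigma> r Q q\<^sub>0 \<delta> F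
    using ans \<open>[] \<in> L\<close>
    by unfold_locales (simp_all add: abstract_numeration_system_def strict_linear_order_on_def)
  obtain M :: "(nat, 'd \<Rightarrow> 'a option, 'g) dfao" where M: "is_dfao (padded_alphabet \<Sigma>) \<Gamma> M"
    and x: "\<And>n. dfao_output M (pad (\<lambda>i. rep_L (n i))) = x n"
    using aut unfolding automatic_def by blast
  obtain s t S where "s \<le> t" and S: "strict_mono S" "S 0 = 0" "2 \<le> S 1"
    and drop: "\<And>n c. S n \<le> c \<Longrightarrow> c < S (Suc n) \<Longrightarrow> drop_end t (rep_L c) = drop_end s (rep_L n)"
    and width: "\<And>m n. suffix_type s m = suffix_type s n \<Longrightarrow> S (Suc m) - S m = S (Suc n) - S n"
    and take: "\<And>m n j. suffix_type s m = suffix_type s n \<Longrightarrow> j < S (Suc m) - S m \<Longrightarrow>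
      take_end t (rep_L (S m + j)) = take_end t (rep_L (S n + j))"
    by (rule ex_block_structure) blast
  define st where "st = (column_state (dfao.trans M) (init M) :: ('d \<Rightarrow> 'a list) \<Rightarrow> nat option)"
  \<comment> \<open>The DFAO state is shared by all coordinates, while the automaton for
    \<open>L\<close> runs on each coordinate separately.\<close>
  define Y where "Y n = (st (\<lambda>i. drop_end s (rep_L (n i))), \<lambda>i. suffix_type s (n i))" for n :: "'d \<Rightarrow> nat"
  note st_cong = column_state_cong[of "dfao.trans M" "init M", folded st_def]
  have Y_st: "st (\<lambda>i. drop_end s (rep_L (m i))) = st (\<lambda>i. drop_end s (rep_L (n i)))"
    and Y_type: "suffix_type s (m i) = suffix_type s (n i)" if "Y m = Y n" for m n i
    using that by (simp_all add: Y_def fun_eq_iff)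
  have drop_lists: "drop_end k (rep_L n) \<in> lists \<Sigma>" for k n
    using rep_in_lists[of n] by (auto simp: drop_end_def dest: in_set_takeD)
  show ?thesis
  proof (rule ex_morphism_of_self_similar[OF S])
    define B where "B = Q \<times> {z. set z \<subseteq> \<Sigma> \<and> length z \<le> s}"
    have type_B: "suffix_type s n \<in> B" for n
      using run_in_Q[OF drop_lists] rep_in_lists[of n]
      by (auto simp: B_def suffix_type_def length_take_end take_end_def dest: in_set_dropD)
    have st_closed: "st w \<in> insert None (Some ` states M)" if "\<And>i. w i \<in> lists \<Sigma>" for w
      unfolding st_def using M that by (intro column_state_closed) (auto simp: is_dfao_def)
    have "Y n \<in> insert None (Some ` states M) \<times> (UNIV \<rightarrow>\<^sub>E B)" for n
      unfolding Y_def by (intro SigmaI PiE_I st_closed drop_lists type_B) simp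
    then have "range Y \<subseteq> insert None (Some ` states M) \<times> (UNIV \<rightarrow>\<^sub>E B)" by blast
    moreover have "finite B"
      unfolding B_def using finite_Q finite_lists_length_le[OF finite_\<Sigma>] by simp
    then have "finite (insert None (Some ` states M) \<times> (UNIV \<rightarrow>\<^sub>E B :: ('d \<Rightarrow> _) set))"
      using M by (intro finite_cartesian_product finite_PiE) (auto simp: is_dfao_def)
    ultimately show "finite (range Y)" by (rule finite_subset)
  next
    fix m n :: "'d \<Rightarrow> nat" assume Y: "Y m = Y n"
    show "S (Suc (m i)) - S (m i) = S (Suc (n i)) - S (n i)" for i
      by (rule width[OF Y_type[OF Y]])
    show "x m = x n"
    proof -
      \<comment> \<open>Reading the recorded last \<open>s\<close> letters of each word completes
        the run of the DFAO.\<close>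
      have "st (\<lambda>i. rep_L (m i)) = st (\<lambda>i. rep_L (n i))"
        using Y_st[OF Y] Y_type[OF Y] by - (rule st_cong[of s], simp_all add: suffix_type_def)
      then show ?thesis
        by (simp add: x[symmetric] dfao_output_def foldl_pad st_def)
    qed
    fix r :: "'d \<Rightarrow> nat" assume r: "\<And>i. r i < S (Suc (m i)) - S (m i)"
    define c where "c i = rep_L (S (m i) + r i)" for i
    define c' where "c' i = rep_L (S (n i) + r i)" for i
    have drop_c: "drop_end t (c i) = drop_end s (rep_L (m i))" for i
      unfolding c_def using r[of i] by (intro drop) auto
    have drop_c': "drop_end t (c' i) = drop_end s (rep_L (n i))" for i
      unfolding c'_def using r[of i] width[OF Y_type[OF Y], of i] by (intro drop) auto
    have take_c: "take_end t (c i) = take_end t (c' i)" for i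
      unfolding c_def c'_def by (rule take[OF Y_type[OF Y] r])
    have t: "t - s + s = t" using \<open>s \<le> t\<close> by simp
    \<comment> \<open>A child's word is the prefix inherited from its parent, followed by at most
      \<open>t - s\<close> middle letters and its own last \<open>s\<close> letters. States agree at
      the inherited prefix, and equal middle parts carry this to the prefix that the child
      records.\<close>
    have middle: "take_end (t - s) (drop_end s (c i)) = take_end (t - s) (drop_end s (c' i))" for i
      by (simp add: take_end_drop_end t take_c)
    have "st (\<lambda>i. drop_end s (c i)) = st (\<lambda>i. drop_end s (c' i))"
      using Y_st[OF Y] middle
      by - (rule st_cong[of "t - s"], simp_all add: drop_end_drop_end t drop_c drop_c')
    moreover have "run (drop_end s (c i)) = run (drop_end s (c' i))" for i
    proof -
      have split: "run u = foldl \<delta> (run (drop_end (t - s) u)) (take_end (t - s) u)" for u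
        unfolding run_def foldl_append[symmetric] drop_end_append_take_end ..
      have "run (drop_end s (rep_L (m i))) = run (drop_end s (rep_L (n i)))"
        using Y_type[OF Y, of i] by (simp add: suffix_type_def)
      then show ?thesis
        by (simp add: split[of "drop_end s _"] drop_end_drop_end t drop_c drop_c' middle)
    qed
    moreover have "take_end s (c i) = take_end s (c' i)" for i
      using take_c take_end_take_end[OF \<open>s \<le> t\<close>] by metis
    ultimately show "Y (\<lambda>i. S (m i) + r i) = Y (\<lambda>i. S (n i) + r i)"
      by (simp add: Y_def suffix_type_def c_def c'_def)
  qed (fact \<Gamma>)
qed

theorem theorem24:
  fixes x :: "('d::finite \<Rightarrow> nat) \<Rightarrow> 'g" and \<Gamma> :: "'g set"
  assumes "finite \<Gamma>" and "range x \<subseteq> \<Gamma>"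
  shows "(\<exists>(L :: nat list set) \<Sigma> r.
            abstract_numeration_system L \<Sigma> r \<and> [] \<in> L \<and> automatic L \<Sigma> r \<Gamma> x)
     \<longleftrightarrow> (\<exists>(\<Xi> :: nat set) (\<mu> :: nat \<Rightarrow> ('d, nat) picture) a \<nu>.
            finite \<Xi> \<and> multidim_morphism \<Xi> \<mu> \<and> a \<in> \<Xi> \<and> prolongable \<mu> a \<and>
            infinite_word (morphism_limit \<mu> a) \<and>
            shape_symmetric \<mu> (morphism_limit \<mu> a) \<and>
            \<nu> \<in> \<Xi> \<rightarrow> \<Gamma> \<and> (\<forall>n. x n = \<nu> (letter (morphism_limit \<mu> a) n)))"
    (is "?automatic \<longleftrightarrow> ?morphic")
proof
  assume ?automatic
  then show ?morphic using morphic_of_automatic assms(2) by blast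
next
  assume ?morphic
  then obtain \<Xi> :: "nat set" and \<mu> :: "nat \<Rightarrow> ('d, nat) picture" and a \<nu> where
    "finite \<Xi>" and \<mu>: "multidim_morphism \<Xi> \<mu>" "a \<in> \<Xi>" "prolongable \<mu> a"
      "infinite_word (morphism_limit \<mu> a)" "shape_symmetric \<mu> (morphism_limit \<mu> a)"
    and x: "\<And>n. x n = \<nu> (letter (morphism_limit \<mu> a) n)"
    by blast
  obtain S where S: "mono S" "S 0 = 0" "\<And>p. 1 \<le> p \<Longrightarrow> p < S p"
    and \<Xi>: "range (letter (morphism_limit \<mu> a)) \<subseteq> \<Xi>"
    and blocks: "\<And>n i. shape (\<mu> (letter (morphism_limit \<mu> a) n)) i = enat (S (Suc (n i)) - S (n i))"
      "\<And>n r. (\<And>i. r i < S (Suc (n i)) - S (n i)) \<Longrightarrow>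
        letter (\<mu> (letter (morphism_limit \<mu> a) n)) r
          = letter (morphism_limit \<mu> a) (\<lambda>i. S (n i) + r i)"
    using shape_symmetric_blocks[OF \<mu>(1-3) refl \<mu>(4,5)] by blast
  show ?automatic
    by (rule automatic_of_blocks[OF S finite_subset[OF \<Xi> \<open>finite \<Xi>\<close>] blocks x assms(2)])
qed

end
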